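(* Let $m\ge 2$, $0<a<b$, let $f$ be a $C^{1,\alpha}$ nonlinearity, and let $$A=\{x\in\mathbb{R}^{2m}: a<|x|<b\},\qquad D=\Big\{z\in\mathbb{R}^{m+1}: \tfrac{a^2}{2}<|z|<\tfrac{b^2}{2}\Big\}.$$ Consider the problems $$(P_A)\quad -\Delta u=f(u)\ \text{ in } A,\qquad u=0 \ \text{ or }\ \frac{\partial u}{\partial\nu}=0\ \text{ on }\partial A,$$ $$(P_D)\quad -\Delta v=\frac{f(v)}{2|z|}\ \text{ in } D,\qquad v=0\ \text{ or }\ \frac{\partial v}{\partial\nu}=0\ \text{ on }\partial D,$$ with the same type of boundary condition (Dirichlet in both, or Neumann in both). Then there is a bijective correspondence between solutions of $(P_A)$ in $X$ and solutions of $(P_D)$ in $Y$.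
   Context: Write $x\in\mathbb{R}^{2m}$ as $x=(y_1,y_2)$ with $y_1,y_2\in\mathbb{R}^m$. Define $$X=\{u\in C^{2,\alpha}(\overline A): u(x)=w(|y_1|,|y_2|)\ \text{for some function } w\},$$ $$Y=\{v\in C^{2,\alpha}(\overline D): v \text{ is axially symmetric}\}.$$ A function $v\in C(\overline D)$ is called axially symmetric if there is a unit vector $p\in\mathbb{R}^{m+1}$ such that $v(z)$ depends only on $|z|$ and $\varphi=\arccos\big(\frac{z}{|z|}\cdot p\big)$. Solutions are classical $C^{2,\alpha}$ solutions, and $\nu$ denotes the unit normal to the boundary.
   Formalization: Y is taken with one fixed (arbitrary) axis p for all v, instead of an axis that may depend on v; with a variable axis all rotations of a nonradial solution would lie in Y and the claim fails, e.g. for f(u)=λ(u-u^3) with Neumann conditions. *)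

theory Defs
  imports "HOL-Analysis.Analysis" "HOL-Library.FuncSet"
begin

text \<open>
  The Hoelder space C^{k,alpha}(closure S) of an open set S: all partial derivatives of order at
  most k exist in S and extend continuously to the closure of S, and those of order k are uniformly
  Hoelder continuous in S with exponent alpha.  In the recursion, \<open>G i\<close> is the extension to
  the closure of the partial derivative of u in direction i.  Only the values of u on the closure
  of S matter.
\<close>

primrec C_holder :: "nat \<Rightarrow> real \<Rightarrow> 'a::euclidean_space set \<Rightarrow> ('a \<Rightarrow> real) \<Rightarrow> bool" where
  "C_holder 0 \<alpha> S u \<longleftrightarrow>
     continuous_on (closure S) u \<and>
     (\<exists>K. \<forall>x\<in>S. \<forall>y\<in>S. \<bar>u x - u y\<bar> \<le> K * dist x y powr \<alpha>)"
| "C_holder (Suc k) \<alpha> S u \<longleftrightarrow>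
     continuous_on (closure S) u \<and>
     (\<exists>G. (\<forall>x\<in>S. (u has_derivative (\<lambda>h. \<Sum>i\<in>Basis. G i x * (h \<bullet> i))) (at x)) \<and>
          (\<forall>i\<in>Basis. C_holder k \<alpha> S (G i)))"

text \<open>Nonlinearities are defined on the whole line, and the Hoelder bound is local (so that, e.g.,
  powers are included).\<close>

definition C1_holder_nonlinearity :: "real \<Rightarrow> (real \<Rightarrow> real) \<Rightarrow> bool" where
  "C1_holder_nonlinearity \<alpha> f \<longleftrightarrow> (\<forall>M>0. C_holder 1 \<alpha> {-M<..<M} f)"

definition partial_deriv :: "'a::euclidean_space \<Rightarrow> ('a \<Rightarrow> real) \<Rightarrow> 'a \<Rightarrow> real" where
  "partial_deriv i u x = deriv (\<lambda>t. u (x + t *\<^sub>R i)) 0"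

definition laplacian :: "('a::euclidean_space \<Rightarrow> real) \<Rightarrow> 'a \<Rightarrow> real" where
  "laplacian u x = (\<Sum>i\<in>Basis. partial_deriv i (partial_deriv i u) x)"

definition annulus :: "real \<Rightarrow> real \<Rightarrow> 'a::euclidean_space set" where
  "annulus r R = {x. r < norm x \<and> norm x < R}"

text \<open>The outward unit normal of \<open>annulus r R\<close> at a boundary point.\<close>

definition annulus_normal :: "real \<Rightarrow> 'a::euclidean_space \<Rightarrow> 'a" where
  "annulus_normal R x = (if norm x = R then sgn x else - sgn x)"

text \<open>The one-sided derivative of u at the boundary point x along the outward normal n, taken from
  inside the domain; for u in C^1 up to the boundary it is the inner product of n with the
  continuous extension of the gradient.\<close>

definition has_normal_derivative ::
    "('a::euclidean_space \<Rightarrow> real) \<Rightarrow> real \<Rightarrow> 'a \<Rightarrow> 'a \<Rightarrow> bool" where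
  "has_normal_derivative u d n x \<longleftrightarrow>
     ((\<lambda>t. u (x + t *\<^sub>R n)) has_real_derivative d) (at_left 0)"

datatype boundary_type = Dirichlet | Neumann

fun boundary_condition ::
    "boundary_type \<Rightarrow> real \<Rightarrow> real \<Rightarrow> ('a::euclidean_space \<Rightarrow> real) \<Rightarrow> bool" where
  "boundary_condition Dirichlet r R u \<longleftrightarrow>
     (\<forall>x\<in>frontier (annulus r R). u x = 0)"
| "boundary_condition Neumann r R u \<longleftrightarrow>
     (\<forall>x\<in>frontier (annulus r R). has_normal_derivative u 0 (annulus_normal R x) x)"

definition solves_PA ::
    "boundary_type \<Rightarrow> (real \<Rightarrow> real) \<Rightarrow> real \<Rightarrow> real \<Rightarrow> ('a::euclidean_space \<Rightarrow> real) \<Rightarrow> bool" where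
  "solves_PA bc f a b u \<longleftrightarrow>
     (\<forall>x\<in>annulus a b. - laplacian u x = f (u x)) \<and> boundary_condition bc a b u"

definition solves_PD ::
    "boundary_type \<Rightarrow> (real \<Rightarrow> real) \<Rightarrow> real \<Rightarrow> real \<Rightarrow> ('a::euclidean_space \<Rightarrow> real) \<Rightarrow> bool" where
  "solves_PD bc f a b v \<longleftrightarrow>
     (\<forall>z\<in>annulus (a\<^sup>2/2) (b\<^sup>2/2). - laplacian v z = f (v z) / (2 * norm z)) \<and>
     boundary_condition bc (a\<^sup>2/2) (b\<^sup>2/2) v"

text \<open>A function on the closure of a domain is represented by the total function that agrees with
  it there and is \<open>undefined\<close> elsewhere; thus equality of elements of the two spaces below
  is equality of functions on the closed annulus.\<close>

definition space_X :: "real \<Rightarrow> real \<Rightarrow> real \<Rightarrow> ((real^'m) \<times> (real^'m) \<Rightarrow> real) set" where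
  "space_X \<alpha> a b =
     {u \<in> extensional (closure (annulus a b)).
        C_holder 2 \<alpha> (annulus a b) u \<and>
        (\<exists>w. \<forall>x\<in>closure (annulus a b). u x = w (norm (fst x)) (norm (snd x)))}"

definition axially_symmetric_on :: "'a::euclidean_space set \<Rightarrow> 'a \<Rightarrow> ('a \<Rightarrow> real) \<Rightarrow> bool" where
  "axially_symmetric_on S p v \<longleftrightarrow>
     (\<exists>g. \<forall>z\<in>S. v z = g (norm z) (arccos ((z /\<^sub>R norm z) \<bullet> p)))"

text \<open>The symmetry axis p is a parameter of the space.  If it were allowed to vary with v, all
  rotations of a nonradial solution would belong to the space, whereas the decomposition
  x = (y1, y2) is fixed; no bijection could then be expected.\<close>

definition space_Y :: "real \<Rightarrow> real \<Rightarrow> real \<Rightarrow> real^'n \<Rightarrow> (real^'n \<Rightarrow> real) set" where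
  "space_Y \<alpha> a b p =
     {v \<in> extensional (closure (annulus (a\<^sup>2/2) (b\<^sup>2/2))).
        C_holder 2 \<alpha> (annulus (a\<^sup>2/2) (b\<^sup>2/2)) v \<and>
        axially_symmetric_on (closure (annulus (a\<^sup>2/2) (b\<^sup>2/2))) p v}"

end

theory Submission
  imports Defs
begin

text \<open>
  Write a point of the annulus A as \<open>x = (y1, y2)\<close> with \<open>\<bar>y1\<bar> = r cos \<theta>\<close> and
  \<open>\<bar>y2\<bar> = r sin \<theta>\<close>.  Squaring the complex number \<open>\<bar>y1\<bar> + \<i> \<bar>y2\<bar>\<close> and dividing by 2 gives
  the radius \<open>r\<^sup>2 / 2\<close> and the angle \<open>\<phi> = 2 \<theta>\<close>, which ranges over \<open>[0, \<pi>]\<close>: these are the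
  coordinates (distance from the origin, angle with p) of points of D.  So functions of
  \<open>\<bar>y1\<bar>, \<bar>y2\<bar>\<close> on the closure of A correspond bijectively to functions on the closure of D that are
  symmetric about p.  The bijection is \<open>u \<mapsto> u \<circ> \<sigma>\<close> with inverse \<open>v \<mapsto> v \<circ> \<tau>\<close>, where \<open>\<tau> x\<close> has the
  component \<open>(\<bar>y1\<bar>\<^sup>2 - \<bar>y2\<bar>\<^sup>2) / 2\<close> along p and the distance \<open>\<bar>y1\<bar> \<bar>y2\<bar>\<close> from the axis, and
  \<open>\<sigma>\<close> is a section of this map up to rotations.

  The equation.  For \<open>u = v \<circ> \<tau>\<close> the Laplacian of u at x is \<open>2 \<bar>\<tau> x\<bar>\<close> times the Laplacian of v at
  \<open>\<tau> x\<close>.  Off the axes this is the chain rule for functions of two scalar quantities, applied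
  once in each space with the same function of two variables (\<open>laplacian_pullback_off_axis\<close>); the
  general case follows by continuity.  The angular terms match because the dimensions of the two
  spaces are 2 m and m + 1.

  The boundary conditions.  Both maps are positively homogeneous, so they carry radial segments to
  radial segments (\<open>boundary_condition_pullback\<close>).

  The regularity is the delicate point, because \<open>\<tau>\<close> is not differentiable where \<open>y1\<close> or \<open>y2\<close>
  vanishes, and \<open>\<sigma>\<close> is not differentiable on the axis.  The symmetry resolves it: the direction in
  which \<open>\<tau> x\<close> leaves the axis is irrelevant for v and may depend on x.  With J an isometry onto
  the hyperplane orthogonal to p, the vector \<open>\<bar>y1\<bar> J y2\<close> is a legitimate choice, smooth across
  \<open>y2 = 0\<close>, and \<open>\<bar>y2\<bar> J y1\<close> is one that is smooth across \<open>y1 = 0\<close>.  Similarly \<open>\<sigma>\<close> has one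
  smooth replacement off each half of the axis.  So locally both pullbacks are compositions with
  smooth maps, and the local pieces are glued (\<open>full_hoelder_pullback_\<tau>\<close>,
  \<open>full_hoelder_pullback_\<sigma>\<close>).  For compositions and gluing the Hoelder spaces are rewritten as
  a class of functions on the open annulus whose derivatives of all orders up to k are Hoelder
  continuous.
\<close>

section \<open>Hoelder continuous functions\<close>

definition hoelder_on :: "real \<Rightarrow> 'a::metric_space set \<Rightarrow> ('a \<Rightarrow> real) \<Rightarrow> bool" where
  "hoelder_on \<alpha> S u \<longleftrightarrow> (\<exists>K. \<forall>x\<in>S. \<forall>y\<in>S. \<bar>u x - u y\<bar> \<le> K * dist x y powr \<alpha>)"

lemma hoelder_onI:
  assumes "\<And>x y. x \<in> S \<Longrightarrow> y \<in> S \<Longrightarrow> \<bar>u x - u y\<bar> \<le> K * dist x y powr \<alpha>"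
  shows "hoelder_on \<alpha> S u"
  using assms unfolding hoelder_on_def by blast

lemma hoelder_on_constant:
  assumes "hoelder_on \<alpha> S u"
  shows "\<exists>K\<ge>0. \<forall>x\<in>S. \<forall>y\<in>S. \<bar>u x - u y\<bar> \<le> K * dist x y powr \<alpha>"
proof -
  obtain K where K: "\<forall>x\<in>S. \<forall>y\<in>S. \<bar>u x - u y\<bar> \<le> K * dist x y powr \<alpha>"
    using assms unfolding hoelder_on_def by blast
  have "\<bar>u x - u y\<bar> \<le> \<bar>K\<bar> * dist x y powr \<alpha>" if "x \<in> S" "y \<in> S" for x y
  proof -
    have "K * dist x y powr \<alpha> \<le> \<bar>K\<bar> * dist x y powr \<alpha>"
      by (intro mult_right_mono) auto
    with K that show ?thesis by fastforce
  qed
  then show ?thesis by (intro exI[of _ "\<bar>K\<bar>"]) auto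
qed

lemma hoelder_on_cong: "(\<And>x. x \<in> S \<Longrightarrow> u x = v x) \<Longrightarrow> hoelder_on \<alpha> S u \<longleftrightarrow> hoelder_on \<alpha> S v"
  unfolding hoelder_on_def by auto

lemma hoelder_on_bounded:
  assumes "hoelder_on \<alpha> S u" "bounded S" "0 \<le> \<alpha>"
  shows "\<exists>B\<ge>0. \<forall>x\<in>S. \<bar>u x\<bar> \<le> B"
proof (cases "S = {}")
  case False
  then obtain x0 where x0: "x0 \<in> S" by blast
  obtain K where K: "K \<ge> 0" "\<And>x y. x \<in> S \<Longrightarrow> y \<in> S \<Longrightarrow> \<bar>u x - u y\<bar> \<le> K * dist x y powr \<alpha>"
    using hoelder_on_constant[OF assms(1)] by metis
  have le: "\<bar>u x\<bar> \<le> \<bar>u x0\<bar> + K * diameter S powr \<alpha>" if "x \<in> S" for x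
  proof -
    have "dist x x0 powr \<alpha> \<le> diameter S powr \<alpha>"
      using diameter_bounded_bound[OF assms(2) that x0] assms(3) by (intro powr_mono2) auto
    then have "\<bar>u x - u x0\<bar> \<le> K * diameter S powr \<alpha>"
      using K(2)[OF that x0] mult_left_mono[OF _ K(1)] by (meson order_trans)
    then show ?thesis by linarith
  qed
  have "0 \<le> \<bar>u x0\<bar> + K * diameter S powr \<alpha>" using le[OF x0] by linarith
  with le show ?thesis by blast
qed auto

lemma hoelder_on_const: "hoelder_on \<alpha> S (\<lambda>x. c)"
  by (rule hoelder_onI[where K = 0]) auto

lemma hoelder_on_add:
  assumes "hoelder_on \<alpha> S u" "hoelder_on \<alpha> S v"
  shows "hoelder_on \<alpha> S (\<lambda>x. u x + v x)"
proof -
  obtain K where K: "K \<ge> 0" "\<And>x y. x \<in> S \<Longrightarrow> y \<in> S \<Longrightarrow> \<bar>u x - u y\<bar> \<le> K * dist x y powr \<alpha>"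
    using hoelder_on_constant[OF assms(1)] by metis
  obtain L where L: "L \<ge> 0" "\<And>x y. x \<in> S \<Longrightarrow> y \<in> S \<Longrightarrow> \<bar>v x - v y\<bar> \<le> L * dist x y powr \<alpha>"
    using hoelder_on_constant[OF assms(2)] by metis
  show ?thesis
  proof (rule hoelder_onI[where K = "K + L"])
    fix x y assume "x \<in> S" "y \<in> S"
    then show "\<bar>u x + v x - (u y + v y)\<bar> \<le> (K + L) * dist x y powr \<alpha>"
      using K(2)[of x y] L(2)[of x y] unfolding distrib_right by linarith
  qed
qed

lemma hoelder_on_mult:
  assumes "hoelder_on \<alpha> S u" "hoelder_on \<alpha> S v" "bounded S" "0 \<le> \<alpha>"
  shows "hoelder_on \<alpha> S (\<lambda>x. u x * v x)"
proof -
  obtain K where K: "K \<ge> 0" "\<And>x y. x \<in> S \<Longrightarrow> y \<in> S \<Longrightarrow> \<bar>u x - u y\<bar> \<le> K * dist x y powr \<alpha>"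
    using hoelder_on_constant[OF assms(1)] by metis
  obtain L where L: "L \<ge> 0" "\<And>x y. x \<in> S \<Longrightarrow> y \<in> S \<Longrightarrow> \<bar>v x - v y\<bar> \<le> L * dist x y powr \<alpha>"
    using hoelder_on_constant[OF assms(2)] by metis
  obtain B where B: "B \<ge> 0" "\<And>x. x \<in> S \<Longrightarrow> \<bar>u x\<bar> \<le> B" using hoelder_on_bounded[OF assms(1,3,4)] by metis
  obtain C where C: "C \<ge> 0" "\<And>x. x \<in> S \<Longrightarrow> \<bar>v x\<bar> \<le> C" using hoelder_on_bounded[OF assms(2,3,4)] by metis
  show ?thesis
  proof (rule hoelder_onI[where K = "B * L + C * K"])
    fix x y assume xy: "x \<in> S" "y \<in> S"
    have "u x * v x - u y * v y = u x * (v x - v y) + v y * (u x - u y)" by algebra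
    then have "\<bar>u x * v x - u y * v y\<bar> \<le> \<bar>u x\<bar> * \<bar>v x - v y\<bar> + \<bar>v y\<bar> * \<bar>u x - u y\<bar>"
      by (metis abs_mult abs_triangle_ineq)
    also have "\<dots> \<le> B * (L * dist x y powr \<alpha>) + C * (K * dist x y powr \<alpha>)"
      using xy K L B C by (intro add_mono mult_mono) auto
    finally show "\<bar>u x * v x - u y * v y\<bar> \<le> (B * L + C * K) * dist x y powr \<alpha>"
      by (simp add: algebra_simps)
  qed
qed

lemma hoelder_on_compose:
  assumes "hoelder_on \<alpha> S u" "0 \<le> \<alpha>" "\<phi> ` T \<subseteq> S"
    and "0 \<le> L" "\<And>x y. x \<in> T \<Longrightarrow> y \<in> T \<Longrightarrow> dist (\<phi> x) (\<phi> y) \<le> L * dist x y"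
  shows "hoelder_on \<alpha> T (\<lambda>x. u (\<phi> x))"
proof -
  obtain K where K: "K \<ge> 0" "\<And>x y. x \<in> S \<Longrightarrow> y \<in> S \<Longrightarrow> \<bar>u x - u y\<bar> \<le> K * dist x y powr \<alpha>"
    using hoelder_on_constant[OF assms(1)] by metis
  show ?thesis
  proof (rule hoelder_onI[where K = "K * L powr \<alpha>"])
    fix x y assume xy: "x \<in> T" "y \<in> T"
    have "\<bar>u (\<phi> x) - u (\<phi> y)\<bar> \<le> K * dist (\<phi> x) (\<phi> y) powr \<alpha>"
      using K(2) xy assms(3) by blast
    also have "\<dots> \<le> K * (L * dist x y) powr \<alpha>"
      using K(1) assms(2,5) xy by (intro mult_left_mono powr_mono2) auto
    finally show "\<bar>u (\<phi> x) - u (\<phi> y)\<bar> \<le> K * L powr \<alpha> * dist x y powr \<alpha>"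
      using assms(4) by (simp add: powr_mult)
  qed
qed

text \<open>
  On a bounded set distances are at most the diameter, which absorbs the surplus exponent.
\<close>

lemma hoelder_on_exponent_mono:
  assumes "hoelder_on \<beta> S u" "bounded S" "0 < \<alpha>" "\<alpha> \<le> \<beta>"
  shows "hoelder_on \<alpha> S u"
proof -
  obtain K where K: "K \<ge> 0" "\<And>x y. x \<in> S \<Longrightarrow> y \<in> S \<Longrightarrow> \<bar>u x - u y\<bar> \<le> K * dist x y powr \<beta>"
    using hoelder_on_constant[OF assms(1)] by metis
  show ?thesis
  proof (rule hoelder_onI[where K = "K * diameter S powr (\<beta> - \<alpha>)"])
    fix x y assume xy: "x \<in> S" "y \<in> S"
    have "dist x y powr \<beta> = dist x y powr (\<beta> - \<alpha>) * dist x y powr \<alpha>"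
      by (simp flip: powr_add)
    also have "\<dots> \<le> diameter S powr (\<beta> - \<alpha>) * dist x y powr \<alpha>"
      using diameter_bounded_bound[OF assms(2) xy] assms(4)
      by (intro mult_right_mono powr_mono2) auto
    finally show "\<bar>u x - u y\<bar> \<le> K * diameter S powr (\<beta> - \<alpha>) * dist x y powr \<alpha>"
      using K(2)[OF xy] mult_left_mono[OF _ K(1)] by (metis mult.assoc order_trans)
  qed
qed

lemma hoelder_on_imp_uniformly_continuous_on:
  assumes "hoelder_on \<alpha> S u" "0 < \<alpha>"
  shows "uniformly_continuous_on S u"
  unfolding uniformly_continuous_on_def
proof (intro allI impI)
  fix e :: real assume e: "0 < e"
  obtain K where K: "K \<ge> 0" "\<And>x y. x \<in> S \<Longrightarrow> y \<in> S \<Longrightarrow> \<bar>u x - u y\<bar> \<le> K * dist x y powr \<alpha>"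
    using hoelder_on_constant[OF assms(1)] by metis
  define d where "d = (e / (K + 1)) powr (1 / \<alpha>)"
  have d: "d > 0" using e K(1) by (simp add: d_def)
  have da: "d powr \<alpha> = e / (K + 1)"
    using e K(1) assms(2) by (simp add: d_def powr_powr)
  show "\<exists>d>0. \<forall>x\<in>S. \<forall>y\<in>S. dist y x < d \<longrightarrow> dist (u y) (u x) < e"
  proof (intro exI[of _ d] conjI ballI impI d)
    fix x y assume xy: "x \<in> S" "y \<in> S" "dist y x < d"
    have "dist y x powr \<alpha> \<le> e / (K + 1)"
      using xy(3) assms(2) powr_mono2[of \<alpha> "dist y x" d] da by auto
    then have "K * dist y x powr \<alpha> \<le> K * (e / (K + 1))" using K(1) by (rule mult_left_mono)
    also have "\<dots> < e" using e K(1) by (simp add: field_simps)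
    finally show "dist (u y) (u x) < e" using K(2)[of y x] xy by (simp add: dist_real_def)
  qed
qed

text \<open>
  For two points that do not lie in a common piece the distance is bounded below by the gap d, so
  that the boundedness of u alone gives the estimate.
\<close>

lemma hoelder_on_Un:
  assumes "hoelder_on \<alpha> S u" "hoelder_on \<alpha> T u" "bounded S" "bounded T" "0 \<le> \<alpha>"
    and "0 < d" "\<And>x y. x \<in> S - T \<Longrightarrow> y \<in> T - S \<Longrightarrow> d \<le> dist x y"
  shows "hoelder_on \<alpha> (S \<union> T) u"
proof -
  obtain K where K: "K \<ge> 0" "\<And>x y. x \<in> S \<Longrightarrow> y \<in> S \<Longrightarrow> \<bar>u x - u y\<bar> \<le> K * dist x y powr \<alpha>"
    using hoelder_on_constant[OF assms(1)] by metis
  obtain L where L: "L \<ge> 0" "\<And>x y. x \<in> T \<Longrightarrow> y \<in> T \<Longrightarrow> \<bar>u x - u y\<bar> \<le> L * dist x y powr \<alpha>"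
    using hoelder_on_constant[OF assms(2)] by metis
  obtain B where B: "B \<ge> 0" "\<And>x. x \<in> S \<Longrightarrow> \<bar>u x\<bar> \<le> B" using hoelder_on_bounded[OF assms(1,3,5)] by metis
  obtain C where C: "C \<ge> 0" "\<And>x. x \<in> T \<Longrightarrow> \<bar>u x\<bar> \<le> C" using hoelder_on_bounded[OF assms(2,4,5)] by metis
  define M where "M = (B + C) / d powr \<alpha>"
  have M: "M \<ge> 0" using B(1) C(1) by (simp add: M_def)
  have far: "\<bar>u x - u y\<bar> \<le> M * dist x y powr \<alpha>" if "x \<in> S - T" "y \<in> T - S" for x y
  proof -
    have "\<bar>u x - u y\<bar> \<le> B + C" using B(2)[of x] C(2)[of y] that by fastforce
    also have "\<dots> = M * d powr \<alpha>" using assms(6) by (simp add: M_def)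
    also have "\<dots> \<le> M * dist x y powr \<alpha>"
      using M assms(5,6) assms(7)[OF that] by (intro mult_left_mono powr_mono2) auto
    finally show ?thesis .
  qed
  show ?thesis
  proof (rule hoelder_onI[where K = "K + L + M"])
    fix x y assume xy: "x \<in> S \<union> T" "y \<in> S \<union> T"
    let ?D = "dist x y powr \<alpha>"
    have nn: "0 \<le> K * ?D" "0 \<le> L * ?D" "0 \<le> M * ?D" using K(1) L(1) M by auto
    consider "x \<in> S" "y \<in> S" | "x \<in> T" "y \<in> T" | "x \<in> S - T" "y \<in> T - S" | "y \<in> S - T" "x \<in> T - S"
      using xy by blast
    then have "\<bar>u x - u y\<bar> \<le> K * ?D \<or> \<bar>u x - u y\<bar> \<le> L * ?D \<or> \<bar>u x - u y\<bar> \<le> M * ?D"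
    proof cases
      case 4
      then show ?thesis using far[of y x] by (simp add: dist_commute abs_minus_commute)
    qed (use K L far in blast)+
    then show "\<bar>u x - u y\<bar> \<le> (K + L + M) * ?D"
      using nn unfolding distrib_right by linarith
  qed
qed

section \<open>Functions with Hoelder continuous derivatives of all orders up to k\<close>

text \<open>
  The derivatives of all orders up to k are required to be Hoelder continuous, not only those of
  order k, and only on the open set itself.  With this strengthening the class is closed under
  products and compositions by a plain induction on k: differentiating a product or a composition
  multiplies derivatives of different orders, and each factor must be Hoelder continuous.  Having no
  condition on the boundary makes the class local, which allows gluing.
\<close>

primrec full_hoelder :: "nat \<Rightarrow> real \<Rightarrow> 'a::euclidean_space set \<Rightarrow> ('a \<Rightarrow> real) \<Rightarrow> bool" where
  "full_hoelder 0 \<alpha> S u \<longleftrightarrow> hoelder_on \<alpha> S u"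
| "full_hoelder (Suc k) \<alpha> S u \<longleftrightarrow>
     hoelder_on \<alpha> S u \<and>
     (\<exists>G. (\<forall>x\<in>S. (u has_derivative (\<lambda>h. \<Sum>i\<in>Basis. G i x * (h \<bullet> i))) (at x)) \<and>
          (\<forall>i\<in>Basis. full_hoelder k \<alpha> S (G i)))"

lemma full_hoelder_imp_hoelder_on: "full_hoelder k \<alpha> S u \<Longrightarrow> hoelder_on \<alpha> S u"
  by (cases k) auto

lemma full_hoelder_Suc_imp: "full_hoelder (Suc k) \<alpha> S u \<Longrightarrow> full_hoelder k \<alpha> S u"
proof (induction k arbitrary: u)
  case (Suc k)
  then obtain G where "hoelder_on \<alpha> S u"
    "\<forall>x\<in>S. (u has_derivative (\<lambda>h. \<Sum>i\<in>Basis. G i x * (h \<bullet> i))) (at x)"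
    "\<forall>i\<in>Basis. full_hoelder (Suc k) \<alpha> S (G i)" by (auto simp del: full_hoelder.simps simp: full_hoelder.simps(2)[of "Suc k"])
  with Suc.IH show ?case unfolding full_hoelder.simps(2)[of k] by (intro conjI exI[of _ G]) auto
qed auto

lemma full_hoelder_cong:
  assumes "open S" "\<And>x. x \<in> S \<Longrightarrow> u x = v x" "full_hoelder k \<alpha> S u"
  shows "full_hoelder k \<alpha> S v"
  using assms
proof (cases k)
  case 0
  then show ?thesis using assms hoelder_on_cong[of S u v] by auto
next
  case (Suc l)
  obtain G where G: "\<forall>x\<in>S. (u has_derivative (\<lambda>h. \<Sum>i\<in>Basis. G i x * (h \<bullet> i))) (at x)"
    "\<forall>i\<in>Basis. full_hoelder l \<alpha> S (G i)" using assms(3) Suc by auto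
  have "(v has_derivative (\<lambda>h. \<Sum>i\<in>Basis. G i x * (h \<bullet> i))) (at x)" if "x \<in> S" for x
    using has_derivative_transform_within_open[OF G(1)[rule_format, OF that] assms(1) that] assms(2) by blast
  moreover have "hoelder_on \<alpha> S v"
    using full_hoelder_imp_hoelder_on[OF assms(3)] hoelder_on_cong[of S u v] assms(2) by auto
  ultimately show ?thesis using G(2) Suc by auto
qed

lemma full_hoelder_exponent_mono:
  assumes "full_hoelder k \<beta> S u" "bounded S" "0 < \<alpha>" "\<alpha> \<le> \<beta>"
  shows "full_hoelder k \<alpha> S u"
  using assms(1)
proof (induction k arbitrary: u)
  case 0
  then show ?case using hoelder_on_exponent_mono assms by auto
next
  case (Suc k)
  then obtain G where "hoelder_on \<beta> S u"
    "\<forall>x\<in>S. (u has_derivative (\<lambda>h. \<Sum>i\<in>Basis. G i x * (h \<bullet> i))) (at x)"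
    "\<forall>i\<in>Basis. full_hoelder k \<beta> S (G i)" by auto
  with Suc.IH show ?case using hoelder_on_exponent_mono[of \<beta> S u \<alpha>] assms by auto
qed

lemma full_hoelder_const: "full_hoelder k \<alpha> S (\<lambda>x. c)"
proof (induction k arbitrary: c)
  case (Suc k)
  then show ?case
    by (auto intro!: exI[of _ "\<lambda>i x. 0"] hoelder_on_const)
qed (auto intro: hoelder_on_const)

lemma full_hoelder_add:
  "full_hoelder k \<alpha> S u \<Longrightarrow> full_hoelder k \<alpha> S v \<Longrightarrow> full_hoelder k \<alpha> S (\<lambda>x. u x + v x)"
proof (induction k arbitrary: u v)
  case 0
  then show ?case using hoelder_on_add by auto
next
  case (Suc k)
  obtain G where G: "hoelder_on \<alpha> S u"
    "\<forall>x\<in>S. (u has_derivative (\<lambda>h. \<Sum>i\<in>Basis. G i x * (h \<bullet> i))) (at x)"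
    "\<forall>i\<in>Basis. full_hoelder k \<alpha> S (G i)" using Suc.prems by auto
  obtain F where F: "hoelder_on \<alpha> S v"
    "\<forall>x\<in>S. (v has_derivative (\<lambda>h. \<Sum>i\<in>Basis. F i x * (h \<bullet> i))) (at x)"
    "\<forall>i\<in>Basis. full_hoelder k \<alpha> S (F i)" using Suc.prems by auto
  have "((\<lambda>x. u x + v x) has_derivative (\<lambda>h. \<Sum>i\<in>Basis. (G i x + F i x) * (h \<bullet> i))) (at x)" if "x \<in> S" for x
    using has_derivative_add[OF G(2)[rule_format, OF that] F(2)[rule_format, OF that]]
    by (simp add: distrib_right sum.distrib)
  then show ?case using G F Suc.IH hoelder_on_add[OF G(1) F(1)]
    by (auto intro!: exI[of _ "\<lambda>i x. G i x + F i x"])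
qed

lemma full_hoelder_sum:
  "finite I \<Longrightarrow> (\<And>i. i \<in> I \<Longrightarrow> full_hoelder k \<alpha> S (u i)) \<Longrightarrow> full_hoelder k \<alpha> S (\<lambda>x. \<Sum>i\<in>I. u i x)"
  by (induction I rule: finite_induct) (auto intro: full_hoelder_const full_hoelder_add)

lemma full_hoelder_mult:
  assumes "bounded S" "0 \<le> \<alpha>"
  shows "full_hoelder k \<alpha> S u \<Longrightarrow> full_hoelder k \<alpha> S v \<Longrightarrow> full_hoelder k \<alpha> S (\<lambda>x. u x * v x)"
proof (induction k arbitrary: u v)
  case 0
  then show ?case using hoelder_on_mult assms by auto
next
  case (Suc k)
  obtain G where G: "hoelder_on \<alpha> S u"
    "\<forall>x\<in>S. (u has_derivative (\<lambda>h. \<Sum>i\<in>Basis. G i x * (h \<bullet> i))) (at x)"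
    "\<forall>i\<in>Basis. full_hoelder k \<alpha> S (G i)" using Suc.prems by auto
  obtain F where F: "hoelder_on \<alpha> S v"
    "\<forall>x\<in>S. (v has_derivative (\<lambda>h. \<Sum>i\<in>Basis. F i x * (h \<bullet> i))) (at x)"
    "\<forall>i\<in>Basis. full_hoelder k \<alpha> S (F i)" using Suc.prems by auto
  have "((\<lambda>x. u x * v x) has_derivative (\<lambda>h. \<Sum>i\<in>Basis. (u x * F i x + G i x * v x) * (h \<bullet> i))) (at x)" if "x \<in> S" for x
    using has_derivative_mult[OF G(2)[rule_format, OF that] F(2)[rule_format, OF that]]
    by (simp add: algebra_simps sum.distrib sum_distrib_left)
  moreover have "full_hoelder k \<alpha> S u" "full_hoelder k \<alpha> S v"
    using Suc.prems full_hoelder_Suc_imp by blast+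
  ultimately show ?case using G F Suc.IH hoelder_on_mult[OF G(1) F(1) assms]
    by (auto intro!: exI[of _ "\<lambda>i x. u x * F i x + G i x * v x"] full_hoelder_add)
qed

lemma full_hoelder_bounded_linear:
  assumes "bounded_linear f"
  shows "full_hoelder k 1 S f"
proof -
  obtain K where K: "\<And>x. norm (f x) \<le> norm x * K" using assms bounded_linear.bounded by blast
  have h: "hoelder_on 1 S f"
  proof (rule hoelder_onI[where K = K])
    fix x y :: 'a
    show "\<bar>f x - f y\<bar> \<le> K * dist x y powr 1"
      using K[of "x - y"] by (simp add: linear_diff[OF bounded_linear.linear[OF assms]] dist_norm mult.commute)
  qed
  show ?thesis
  proof (cases k)
    case (Suc l)
    have "(f has_derivative (\<lambda>h. \<Sum>i\<in>Basis. f i * (h \<bullet> i))) (at x)" for x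
    proof -
      have "f h = (\<Sum>i\<in>Basis. f i * (h \<bullet> i))" for h
        by (subst euclidean_representation[of h, symmetric])
          (simp add: linear_sum[OF bounded_linear.linear[OF assms]]
            linear_cmul[OF bounded_linear.linear[OF assms]] mult.commute)
      then have "f = (\<lambda>h. \<Sum>i\<in>Basis. f i * (h \<bullet> i))" by blast
      then show ?thesis using bounded_linear_imp_has_derivative[OF assms, of "at x"] by (rule subst[where P = "\<lambda>g. (f has_derivative g) (at x)"])
    qed
    then show ?thesis using h Suc full_hoelder_const
      by (auto intro!: exI[of _ "\<lambda>i x. f i"])
  qed (use h in auto)
qed

lemma lipschitz_if_components_hoelder_1:
  fixes \<phi> :: "'a::euclidean_space \<Rightarrow> 'b::euclidean_space"
  assumes "\<And>j. j \<in> Basis \<Longrightarrow> hoelder_on 1 T (\<lambda>x. \<phi> x \<bullet> j)"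
  obtains L where "0 \<le> L" "\<And>x y. x \<in> T \<Longrightarrow> y \<in> T \<Longrightarrow> dist (\<phi> x) (\<phi> y) \<le> L * dist x y"
proof -
  have "\<exists>K\<ge>0. \<forall>x\<in>T. \<forall>y\<in>T. \<bar>\<phi> x \<bullet> j - \<phi> y \<bullet> j\<bar> \<le> K * dist x y" if "j \<in> Basis" for j
    using hoelder_on_constant[OF assms[OF that]] by (metis powr_one zero_le_dist)
  then obtain K where K: "\<And>j. j \<in> Basis \<Longrightarrow> K j \<ge> (0::real)"
    "\<And>j x y. j \<in> Basis \<Longrightarrow> x \<in> T \<Longrightarrow> y \<in> T \<Longrightarrow> \<bar>\<phi> x \<bullet> j - \<phi> y \<bullet> j\<bar> \<le> K j * dist x y"
    by metis
  show thesis
  proof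
    show "0 \<le> (\<Sum>j\<in>Basis. K j)" using K(1) by (simp add: sum_nonneg)
    fix x y assume xy: "x \<in> T" "y \<in> T"
    have "dist (\<phi> x) (\<phi> y) \<le> (\<Sum>j\<in>Basis. \<bar>(\<phi> x - \<phi> y) \<bullet> j\<bar>)"
      unfolding dist_norm by (rule norm_le_l1)
    also have "\<dots> \<le> (\<Sum>j\<in>Basis. K j * dist x y)"
      using K(2) xy by (intro sum_mono) (simp add: inner_diff_left)
    finally show "dist (\<phi> x) (\<phi> y) \<le> (\<Sum>j\<in>Basis. K j) * dist x y" by (simp add: sum_distrib_right)
  qed
qed

text \<open>
  The partial derivatives of the composition are sums of products of
  \<open>G j \<circ> \<phi>\<close>, where \<open>G j\<close> are the partial derivatives of u, with those of the
  components of \<open>\<phi>\<close>; the former are covered by the induction hypothesis.  Exponent 1 for the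
  components makes \<open>\<phi>\<close> Lipschitz, so that the exponent \<open>\<alpha>\<close> of u survives.
\<close>

lemma full_hoelder_compose:
  fixes \<phi> :: "'a::euclidean_space \<Rightarrow> 'b::euclidean_space"
  assumes "bounded T" "0 < \<alpha>" "\<alpha> \<le> 1" "\<phi> ` T \<subseteq> S"
  shows "full_hoelder k \<alpha> S u \<Longrightarrow> (\<And>j. j \<in> Basis \<Longrightarrow> full_hoelder k 1 T (\<lambda>x. \<phi> x \<bullet> j)) \<Longrightarrow>
    full_hoelder k \<alpha> T (\<lambda>x. u (\<phi> x))"
proof (induction k arbitrary: u)
  case 0
  obtain L where "0 \<le> L" "\<And>x y. x \<in> T \<Longrightarrow> y \<in> T \<Longrightarrow> dist (\<phi> x) (\<phi> y) \<le> L * dist x y"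
    using lipschitz_if_components_hoelder_1[of T \<phi>] full_hoelder_imp_hoelder_on[OF "0.prems"(2)] by metis
  then show ?case using hoelder_on_compose[of \<alpha> S u \<phi> T L] "0.prems" assms by auto
next
  case (Suc k)
  obtain L where L: "0 \<le> L" "\<And>x y. x \<in> T \<Longrightarrow> y \<in> T \<Longrightarrow> dist (\<phi> x) (\<phi> y) \<le> L * dist x y"
    using lipschitz_if_components_hoelder_1[of T \<phi>] full_hoelder_imp_hoelder_on[OF Suc.prems(2)] by metis
  obtain G where G: "hoelder_on \<alpha> S u"
    "\<forall>x\<in>S. (u has_derivative (\<lambda>h. \<Sum>i\<in>Basis. G i x * (h \<bullet> i))) (at x)"
    "\<forall>i\<in>Basis. full_hoelder k \<alpha> S (G i)" using Suc.prems(1) by auto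
  have "\<exists>F. (\<forall>x\<in>T. ((\<lambda>x. \<phi> x \<bullet> j) has_derivative (\<lambda>h. \<Sum>i\<in>Basis. F i x * (h \<bullet> i))) (at x)) \<and>
          (\<forall>i\<in>Basis. full_hoelder k 1 T (F i))" if "j \<in> Basis" for j
    using Suc.prems(2)[OF that] by auto
  then have "\<forall>j\<in>Basis. \<exists>F. (\<forall>x\<in>T. ((\<lambda>x. \<phi> x \<bullet> j) has_derivative (\<lambda>h. \<Sum>i\<in>Basis. F i x * (h \<bullet> i))) (at x)) \<and>
          (\<forall>i\<in>Basis. full_hoelder k 1 T (F i))" by blast
  from bchoice[OF this] obtain F where F:
    "\<And>j x. j \<in> Basis \<Longrightarrow> x \<in> T \<Longrightarrow> ((\<lambda>x. \<phi> x \<bullet> j) has_derivative (\<lambda>h. \<Sum>i\<in>Basis. F j i x * (h \<bullet> i))) (at x)"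
    "\<And>j i. j \<in> Basis \<Longrightarrow> i \<in> Basis \<Longrightarrow> full_hoelder k 1 T (F j i)" by blast
  have h: "hoelder_on \<alpha> T (\<lambda>x. u (\<phi> x))"
    using hoelder_on_compose[of \<alpha> S u \<phi> T L] L G(1) assms by auto
  have low: "full_hoelder k 1 T (\<lambda>x. \<phi> x \<bullet> j)" if "j \<in> Basis" for j
    using Suc.prems(2)[OF that] full_hoelder_Suc_imp by blast
  have Gc: "full_hoelder k \<alpha> T (\<lambda>x. \<Sum>j\<in>Basis. G j (\<phi> x) * F j i x)" if i: "i \<in> Basis" for i
    using Suc.IH low F(2) G(3) i assms
    by (intro full_hoelder_sum full_hoelder_mult) (auto intro: full_hoelder_exponent_mono[of k 1])
  have D: "((\<lambda>x. u (\<phi> x)) has_derivative (\<lambda>h. \<Sum>i\<in>Basis. (\<Sum>j\<in>Basis. G j (\<phi> x) * F j i x) * (h \<bullet> i))) (at x)"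
    if x: "x \<in> T" for x
  proof -
    have "(\<phi> has_derivative (\<lambda>h. \<Sum>j\<in>Basis. (\<Sum>i\<in>Basis. F j i x * (h \<bullet> i)) *\<^sub>R j)) (at x)"
      using F(1) x by (subst has_derivative_componentwise_within) (simp add: inner_sum_left inner_Basis if_distrib cong: if_cong)
    moreover have "(u has_derivative (\<lambda>h. \<Sum>j\<in>Basis. G j (\<phi> x) * (h \<bullet> j))) (at (\<phi> x))"
      using G(2) x assms(4) by blast
    ultimately have "((\<lambda>x. u (\<phi> x)) has_derivative
        (\<lambda>h. \<Sum>j\<in>Basis. G j (\<phi> x) * ((\<Sum>j\<in>Basis. (\<Sum>i\<in>Basis. F j i x * (h \<bullet> i)) *\<^sub>R j) \<bullet> j))) (at x)"
      using has_derivative_compose by blast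
    moreover have "(\<Sum>j\<in>Basis. G j (\<phi> x) * ((\<Sum>j\<in>Basis. (\<Sum>i\<in>Basis. F j i x * (h \<bullet> i)) *\<^sub>R j) \<bullet> j))
       = (\<Sum>i\<in>Basis. (\<Sum>j\<in>Basis. G j (\<phi> x) * F j i x) * (h \<bullet> i))" for h
    proof -
      have "(\<Sum>j\<in>Basis. G j (\<phi> x) * ((\<Sum>j\<in>Basis. (\<Sum>i\<in>Basis. F j i x * (h \<bullet> i)) *\<^sub>R j) \<bullet> j))
        = (\<Sum>j\<in>Basis. \<Sum>i\<in>Basis. G j (\<phi> x) * F j i x * (h \<bullet> i))"
        by (simp add: sum_distrib_left mult.assoc)
      also have "\<dots> = (\<Sum>i\<in>Basis. (\<Sum>j\<in>Basis. G j (\<phi> x) * F j i x) * (h \<bullet> i))"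
        by (subst sum.swap) (simp add: sum_distrib_right)
      finally show ?thesis .
    qed
    ultimately show ?thesis by simp
  qed
  from h D Gc show ?case by (auto intro!: exI[of _ "\<lambda>i x. \<Sum>j\<in>Basis. G j (\<phi> x) * F j i x"])
qed

text \<open>
  On the overlap the two families of partial derivatives agree because derivatives at interior
  points are unique, so they define one family on the union, to which the induction hypothesis
  applies.
\<close>

lemma full_hoelder_Un:
  assumes "open S" "open T" "bounded S" "bounded T" "0 \<le> \<alpha>"
    and "0 < d" "\<And>x y. x \<in> S - T \<Longrightarrow> y \<in> T - S \<Longrightarrow> d \<le> dist x y"
  shows "full_hoelder k \<alpha> S u \<Longrightarrow> full_hoelder k \<alpha> T u \<Longrightarrow> full_hoelder k \<alpha> (S \<union> T) u"
proof (induction k arbitrary: u)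
  case 0
  then show ?case using hoelder_on_Un[OF _ _ assms(3-7)] by auto
next
  case (Suc k)
  obtain G where G: "hoelder_on \<alpha> S u"
    "\<forall>x\<in>S. (u has_derivative (\<lambda>h. \<Sum>i\<in>Basis. G i x * (h \<bullet> i))) (at x)"
    "\<forall>i\<in>Basis. full_hoelder k \<alpha> S (G i)" using Suc.prems by auto
  obtain F where F: "hoelder_on \<alpha> T u"
    "\<forall>x\<in>T. (u has_derivative (\<lambda>h. \<Sum>i\<in>Basis. F i x * (h \<bullet> i))) (at x)"
    "\<forall>i\<in>Basis. full_hoelder k \<alpha> T (F i)" using Suc.prems by auto
  define H where "H = (\<lambda>i x. if x \<in> S then G i x else F i x)"
  have agree: "G i x = F i x" if "i \<in> Basis" "x \<in> S" "x \<in> T" for i x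
  proof -
    have "(\<lambda>h. \<Sum>i\<in>Basis. G i x * (h \<bullet> i)) = (\<lambda>h. \<Sum>i\<in>Basis. F i x * (h \<bullet> i))"
      using has_derivative_unique G(2) F(2) that by blast
    from fun_cong[OF this, of i] show ?thesis
      using that by (simp add: inner_Basis if_distrib cong: if_cong)
  qed
  have "(u has_derivative (\<lambda>h. \<Sum>i\<in>Basis. H i x * (h \<bullet> i))) (at x)" if "x \<in> S \<union> T" for x
    using that G(2) F(2) by (cases "x \<in> S") (auto simp: H_def)
  moreover have "full_hoelder k \<alpha> (S \<union> T) (H i)" if i: "i \<in> Basis" for i
  proof (rule Suc.IH)
    show "full_hoelder k \<alpha> S (H i)"
      by (rule full_hoelder_cong[OF assms(1) _ G(3)[rule_format, OF i]]) (simp add: H_def)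
    show "full_hoelder k \<alpha> T (H i)"
      by (rule full_hoelder_cong[OF assms(2) _ F(3)[rule_format, OF i]]) (simp add: H_def agree i)
  qed
  ultimately show ?case using hoelder_on_Un[OF G(1) F(1) assms(3-7)] by auto
qed

lemma full_hoelder_powr:
  assumes "0 < c"
  shows "full_hoelder k 1 {c<..<C} (\<lambda>x::real. x powr r)"
proof (induction k arbitrary: r)
  case 0
  have "hoelder_on 1 {c<..<C} (\<lambda>x::real. x powr r)"
  proof (rule hoelder_onI[where K = "\<bar>r\<bar> * (c powr (r - 1) + C powr (r - 1))"])
    fix x y assume xy: "x \<in> {c<..<C}" "y \<in> {c<..<C}"
    have "norm (y powr r - x powr r) \<le> \<bar>r\<bar> * (c powr (r - 1) + C powr (r - 1)) * norm (y - x)"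
    proof (rule field_differentiable_bound[where S = "{c<..<C}" and f' = "\<lambda>x. r * x powr (r - 1)"])
      fix z assume z: "z \<in> {c<..<C}"
      then show "((\<lambda>x. x powr r) has_field_derivative r * z powr (r - 1)) (at z within {c<..<C})"
        using assms by (auto intro!: derivative_eq_intros simp: powr_diff field_simps)
      have "z powr (r - 1) \<le> c powr (r - 1) + C powr (r - 1)"
      proof (cases "r - 1 \<ge> 0")
        case True
        then have "z powr (r - 1) \<le> C powr (r - 1)" using z assms by (intro powr_mono2) auto
        then show ?thesis by (simp add: add_increasing)
      next
        case False
        then have "z powr (r - 1) \<le> c powr (r - 1)" using z assms by (intro powr_mono2') auto
        then show ?thesis by (simp add: add_increasing2)
      qed
      then show "norm (r * z powr (r - 1)) \<le> \<bar>r\<bar> * (c powr (r - 1) + C powr (r - 1))"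
        by (simp add: abs_mult mult_left_mono)
    qed (use xy in auto)
    then show "\<bar>x powr r - y powr r\<bar> \<le> \<bar>r\<bar> * (c powr (r - 1) + C powr (r - 1)) * dist x y powr 1"
      by (simp add: dist_real_def abs_minus_commute)
  qed
  then show ?case by simp
next
  case (Suc k)
  have "hoelder_on 1 {c<..<C} (\<lambda>x::real. x powr r)" using full_hoelder_imp_hoelder_on[OF Suc] .
  moreover have "((\<lambda>x. x powr r) has_derivative (\<lambda>h. r * x powr (r - 1) * h)) (at x)" if "x \<in> {c<..<C}" for x
    using that assms by (auto intro!: derivative_eq_intros simp: powr_diff field_simps has_field_derivative_def[symmetric])
  moreover have "full_hoelder k 1 {c<..<C} (\<lambda>x. r * x powr (r - 1))"
    by (intro full_hoelder_mult full_hoelder_const Suc) auto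
  ultimately show ?case by (auto intro!: exI[of _ "\<lambda>i x. r * x powr (r - 1)"])
qed

section \<open>Annuli and Hoelder spaces up to the boundary\<close>

lemma open_annulus: "open (annulus r R :: 'a::euclidean_space set)"
  unfolding annulus_def by (intro open_Collect_conj open_Collect_less continuous_intros)

lemma bounded_annulus: "bounded (annulus r R :: 'a::euclidean_space set)"
  by (rule bounded_subset[of "ball 0 R"]) (auto simp: annulus_def)

lemma closure_annulus:
  assumes "0 < r" "r < R"
  shows "closure (annulus r R) = {x::'a::euclidean_space. r \<le> norm x \<and> norm x \<le> R}"
proof
  have "closed {x::'a. r \<le> norm x \<and> norm x \<le> R}"
    by (intro closed_Collect_conj closed_Collect_le continuous_intros)
  then show "closure (annulus r R) \<subseteq> {x::'a. r \<le> norm x \<and> norm x \<le> R}"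
    by (rule closure_minimal[rotated]) (auto simp: annulus_def)
  show "{x::'a. r \<le> norm x \<and> norm x \<le> R} \<subseteq> closure (annulus r R)"
  proof clarify
    fix x :: 'a assume x: "r \<le> norm x" "norm x \<le> R"
    define c where "c = (r + R) / 2"
    show "x \<in> closure (annulus r R)"
      unfolding closure_approachable
    proof (intro allI impI)
      fix e :: real assume e: "0 < e"
      define s where "s = min 1 (e / (2 * (\<bar>c - norm x\<bar> + 1)))"
      have s: "0 < s" "s \<le> 1" using e by (auto simp: s_def intro!: divide_pos_pos add_nonneg_pos)
      define y where "y = ((1 - s) * norm x + s * c) *\<^sub>R sgn x"
      have x0: "norm (sgn x) = 1" using x assms by (auto simp: norm_sgn)
      have "r < (1 - s) * norm x + s * c"
      proof -
        have "(1 - s) * r + s * r \<le> (1 - s) * norm x + s * r"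
          using s x by (intro add_right_mono mult_left_mono) auto
        moreover have "s * r < s * c" using s assms by (auto simp: c_def)
        ultimately show ?thesis by (simp add: algebra_simps)
      qed
      moreover have "(1 - s) * norm x + s * c < R"
      proof -
        have "(1 - s) * norm x + s * R \<le> (1 - s) * R + s * R"
          using s x by (intro add_right_mono mult_left_mono) auto
        moreover have "s * c < s * R" using s assms by (auto simp: c_def)
        ultimately show ?thesis by (simp add: algebra_simps)
      qed
      ultimately have "y \<in> annulus r R" using assms x0 by (simp add: y_def annulus_def)
      moreover have "dist y x < e"
      proof -
        have "y - x = (s * (c - norm x)) *\<^sub>R sgn x"
        proof -
          have "norm x \<noteq> 0" using x assms by linarith
          then have "x = norm x *\<^sub>R sgn x" by (simp add: sgn_div_norm)
          then have "y - x = ((1 - s) * norm x + s * c) *\<^sub>R sgn x - norm x *\<^sub>R sgn x"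
            unfolding y_def by argo
          also have "\<dots> = ((1 - s) * norm x + s * c - norm x) *\<^sub>R sgn x" by (simp add: algebra_simps)
          finally show ?thesis by (simp add: algebra_simps)
        qed
        then have "dist y x = s * \<bar>c - norm x\<bar>" using x0 s by (simp add: dist_norm abs_mult)
        also have "\<dots> \<le> e / (2 * (\<bar>c - norm x\<bar> + 1)) * \<bar>c - norm x\<bar>"
          by (intro mult_right_mono) (auto simp: s_def)
        also have "\<dots> < e * 1"
        proof -
          have "\<bar>c - norm x\<bar> / (2 * (\<bar>c - norm x\<bar> + 1)) < 1"
            by (subst divide_less_eq_1_pos) (auto intro: add_nonneg_pos)
          from mult_strict_left_mono[OF this e] show ?thesis by simp
        qed
        finally show ?thesis by simp
      qed
      ultimately show "\<exists>y\<in>annulus r R. dist y x < e" by blast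
    qed
  qed
qed

lemma frontier_annulus:
  assumes "0 < r" "r < R"
  shows "frontier (annulus r R) = {x::'a::euclidean_space. norm x = r \<or> norm x = R}"
  using assms unfolding frontier_def interior_open[OF open_annulus] closure_annulus[OF assms]
  by (auto simp: annulus_def)

text \<open>
  The mean value inequality needs a segment inside the domain, but a chord near the inner sphere
  may leave the annulus.  Scaling both end points by a common factor slightly larger than 1 moves
  the chord outwards by at least its length, and the two radial pieces that are added are of
  comparable length.  This treats all close points; for distant points the bound on u suffices.
\<close>

lemma lipschitz_on_annulus:
  fixes u :: "'a::euclidean_space \<Rightarrow> real"
  assumes "0 < r" "r < R"
    and D: "\<And>x. x \<in> annulus r R \<Longrightarrow> (u has_derivative D x) (at x)"
    and B: "\<And>x. x \<in> annulus r R \<Longrightarrow> onorm (D x) \<le> B"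
    and M: "\<And>x. x \<in> annulus r R \<Longrightarrow> \<bar>u x\<bar> \<le> M"
  shows "\<exists>L\<ge>0. \<forall>x\<in>annulus r R. \<forall>y\<in>annulus r R. \<bar>u x - u y\<bar> \<le> L * dist x y"
proof -
  let ?A = "annulus r R :: 'a set"
  have seg: "\<bar>u x - u y\<bar> \<le> \<bar>B\<bar> * dist x y" if "closed_segment x y \<subseteq> ?A" for x y
  proof -
    have "norm (u x - u y) \<le> \<bar>B\<bar> * norm (x - y)"
    proof (rule differentiable_bound[where S = "closed_segment x y" and f' = D])
      fix z assume "z \<in> closed_segment x y"
      then have z: "z \<in> ?A" using that by blast
      show "(u has_derivative D z) (at z within closed_segment x y)"
        using D[OF z] by (rule has_derivative_at_withinI)
      show "onorm (D z) \<le> \<bar>B\<bar>" using B[OF z] by linarith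
    qed auto
    then show ?thesis by (simp add: dist_norm)
  qed
  have seg_in: "closed_segment x y \<subseteq> ?A"
    if "x \<in> ?A" "y \<in> ?A" "r < norm x - dist x y" for x y
  proof
    fix w assume w: "w \<in> closed_segment x y"
    have "w \<in> ball 0 R"
      using w that(1,2) closed_segment_subset[of x "ball 0 R" y] by (auto simp: annulus_def)
    moreover have "norm (w - x) \<le> norm (x - y)" using segment_bound1[OF w] by (simp add: norm_minus_commute)
    moreover have "norm x \<le> norm w + norm (w - x)"
      by (metis add.commute norm_minus_commute norm_triangle_sub)
    ultimately show "w \<in> ?A" using that(3) by (auto simp: annulus_def dist_norm)
  qed
  (* \<delta> keeps points within \<delta> of the inner half of the annulus below R when they are pushed outwards *)
  define \<delta> where "\<delta> = min ((R - r) / 8) (min ((R - r) * r / (16 * R)) (r / 2))"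
  have \<delta>: "0 < \<delta>" "\<delta> \<le> (R - r) / 8" "\<delta> \<le> (R - r) * r / (16 * R)" "\<delta> \<le> r / 2"
    using assms(1,2) unfolding \<delta>_def by (simp, linarith+)
  define L where "L = \<bar>B\<bar> * (4 * R / r + 2)"
  have L: "0 \<le> L" using assms(1,2) by (simp add: L_def)
  have BL: "\<bar>B\<bar> \<le> L"
  proof -
    have "1 \<le> 4 * R / r + 2" using assms(1,2) by simp
    from mult_left_mono[OF this, of "\<bar>B\<bar>"] show ?thesis by (simp add: L_def)
  qed
  have near: "\<bar>u x - u y\<bar> \<le> L * dist x y" if xy: "x \<in> ?A" "y \<in> ?A" and d: "dist x y < \<delta>" for x y
  proof (cases "norm x \<le> (r + R) / 2")
    case False
    then have "closed_segment x y \<subseteq> ?A" using d \<delta>(2) assms(2) by (intro seg_in xy) (simp add: field_simps)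
    from seg[OF this] BL show ?thesis by (meson mult_right_mono order_trans zero_le_dist)
  next
    case True
    (* the factor \<mu> increases norms in the annulus by at least twice the distance of x and y *)
    define \<mu> where "\<mu> = 1 + 2 * dist x y / r"
    have \<mu>: "1 \<le> \<mu>" "\<mu> \<le> 2" using d \<delta>(4) assms(1) by (auto simp: \<mu>_def field_simps)
    have push: "norm w + 2 * dist x y \<le> norm (\<mu> *\<^sub>R w)" "norm (\<mu> *\<^sub>R w) < R"
      "dist w (\<mu> *\<^sub>R w) \<le> 2 * R / r * dist x y" "closed_segment w (\<mu> *\<^sub>R w) \<subseteq> ?A" "\<mu> *\<^sub>R w \<in> ?A"
      if w: "w \<in> ?A" "norm w \<le> (r + R) / 2 + \<delta>" for w
    proof -
      have n: "norm (\<mu> *\<^sub>R w) = norm w + 2 * dist x y / r * norm w" using \<mu> by (simp only: norm_scaleR abs_of_nonneg) (simp add: \<mu>_def algebra_simps)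
      have "2 * dist x y / r * r \<le> 2 * dist x y / r * norm w"
        using w(1) assms(1) by (intro mult_left_mono) (auto simp: annulus_def)
      then show 1: "norm w + 2 * dist x y \<le> norm (\<mu> *\<^sub>R w)" using n assms(1) by simp
      have le: "2 * dist x y / r * norm w \<le> 2 * dist x y / r * R"
        using w(1) assms(1) by (intro mult_left_mono) (auto simp: annulus_def)
      also have "\<dots> \<le> 2 * \<delta> / r * R" using d assms(1,2) by (intro mult_right_mono divide_right_mono) auto
      also have "\<dots> \<le> (R - r) / 8"
      proof -
        have "\<delta> * (16 * R) \<le> (R - r) * r" using \<delta>(3) assms(1,2) by (simp add: pos_le_divide_eq)
        then show ?thesis using assms(1,2) by (simp add: field_simps)
      qed
      finally show 2: "norm (\<mu> *\<^sub>R w) < R" using n w(2) \<delta>(2) assms(2) by argo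
      have "w - \<mu> *\<^sub>R w = - ((2 * dist x y / r) *\<^sub>R w)" by (simp add: \<mu>_def algebra_simps)
      then have "dist w (\<mu> *\<^sub>R w) = 2 * dist x y / r * norm w" using assms(1) by (simp add: dist_norm)
      with le show "dist w (\<mu> *\<^sub>R w) \<le> 2 * R / r * dist x y" by (simp add: mult_ac)
      show "closed_segment w (\<mu> *\<^sub>R w) \<subseteq> ?A"
      proof
        fix v assume "v \<in> closed_segment w (\<mu> *\<^sub>R w)"
        then obtain t where t: "0 \<le> t" "t \<le> 1" "v = (1 - t) *\<^sub>R w + t *\<^sub>R \<mu> *\<^sub>R w" by (auto simp: in_segment)
        have "v = (1 + t * (\<mu> - 1)) *\<^sub>R w" using t(3) by (simp add: algebra_simps)
        moreover have "0 \<le> t * (\<mu> - 1)" "t * (\<mu> - 1) \<le> \<mu> - 1" using t \<mu> by (auto intro: mult_left_le_one_le)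
        ultimately have v: "norm v = (1 + t * (\<mu> - 1)) * norm w" by simp
        have "1 * norm w \<le> (1 + t * (\<mu> - 1)) * norm w" "(1 + t * (\<mu> - 1)) * norm w \<le> \<mu> * norm w"
          using \<open>0 \<le> t * (\<mu> - 1)\<close> \<open>t * (\<mu> - 1) \<le> \<mu> - 1\<close>
          by (intro mult_right_mono; simp)+
        then show "v \<in> ?A" using v 2 w(1) \<mu> by (auto simp: annulus_def)
      qed
      then show "\<mu> *\<^sub>R w \<in> ?A" by auto
    qed
    have "norm y \<le> norm x + dist x y" by (metis dist_norm norm_minus_commute norm_triangle_sub)
    then have y: "norm y \<le> (r + R) / 2 + \<delta>" using True d by linarith
    have x: "norm x \<le> (r + R) / 2 + \<delta>" using True \<delta>(1) by linarith
    have dd: "dist (\<mu> *\<^sub>R x) (\<mu> *\<^sub>R y) = \<mu> * dist x y"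
      using \<mu> by (simp add: dist_norm flip: scaleR_diff_right)
    then have dd2: "dist (\<mu> *\<^sub>R x) (\<mu> *\<^sub>R y) \<le> 2 * dist x y" using \<mu> by (simp add: mult_right_mono)
    have "closed_segment (\<mu> *\<^sub>R x) (\<mu> *\<^sub>R y) \<subseteq> ?A"
    proof (rule seg_in)
      show "r < norm (\<mu> *\<^sub>R x) - dist (\<mu> *\<^sub>R x) (\<mu> *\<^sub>R y)"
        using push(1)[OF xy(1) x] dd2 xy(1) by (auto simp: annulus_def)
    qed (use push(5) xy x y in auto)
    from seg[OF this] seg[OF push(4)[OF xy(1) x]] seg[OF push(4)[OF xy(2) y]]
    have "\<bar>u x - u y\<bar> \<le> \<bar>B\<bar> * dist x (\<mu> *\<^sub>R x) + \<bar>B\<bar> * dist (\<mu> *\<^sub>R x) (\<mu> *\<^sub>R y) + \<bar>B\<bar> * dist y (\<mu> *\<^sub>R y)"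
      by linarith
    also have "\<dots> \<le> \<bar>B\<bar> * (2 * R / r * dist x y) + \<bar>B\<bar> * (2 * dist x y) + \<bar>B\<bar> * (2 * R / r * dist x y)"
      using push(3)[OF xy(1) x] push(3)[OF xy(2) y] dd2 by (intro add_mono mult_left_mono) auto
    also have "\<dots> = L * dist x y" by (simp add: L_def algebra_simps)
    finally show ?thesis .
  qed
  define N where "N = max L (2 * \<bar>M\<bar> / \<delta>)"
  have "\<bar>u x - u y\<bar> \<le> N * dist x y" if xy: "x \<in> ?A" "y \<in> ?A" for x y
  proof (cases "dist x y < \<delta>")
    case True
    have "L * dist x y \<le> N * dist x y" by (intro mult_right_mono) (auto simp: N_def)
    with near[OF xy True] show ?thesis by linarith
  next
    case False
    have "\<bar>u x - u y\<bar> \<le> 2 * \<bar>M\<bar> / \<delta> * \<delta>" using M[OF xy(1)] M[OF xy(2)] \<delta>(1) by simp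
    also have "\<dots> \<le> N * dist x y" using False \<delta>(1) L by (intro mult_mono) (auto simp: N_def)
    finally show ?thesis .
  qed
  moreover have "0 \<le> N" using L by (simp add: N_def)
  ultimately show ?thesis by blast
qed

lemma C_holder_imp_continuous_on: "C_holder k \<alpha> S u \<Longrightarrow> continuous_on (closure S) u"
  by (cases k) auto

text \<open>
  Derivatives of order below k are Hoelder continuous because their own derivatives extend to the
  compact closure, hence are bounded, and bounded derivatives give a Lipschitz bound on the annulus.
\<close>

lemma C_holder_imp_full_hoelder:
  assumes "0 < r" "r < R" "0 < \<alpha>" "\<alpha> \<le> 1"
  shows "C_holder k \<alpha> (annulus r R) u \<Longrightarrow> full_hoelder k \<alpha> (annulus r R :: 'a::euclidean_space set) u"
proof (induction k arbitrary: u)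
  case 0
  then show ?case by (auto simp: hoelder_on_def)
next
  case (Suc k)
  let ?A = "annulus r R :: 'a set"
  obtain G where G: "\<forall>x\<in>?A. (u has_derivative (\<lambda>h. \<Sum>i\<in>Basis. G i x * (h \<bullet> i))) (at x)"
    "\<forall>i\<in>Basis. C_holder k \<alpha> ?A (G i)" using Suc.prems by auto
  have bnd: "\<exists>B\<ge>0. \<forall>x\<in>?A. \<bar>g x\<bar> \<le> B" if "continuous_on (closure ?A) g" for g :: "'a \<Rightarrow> real"
  proof -
    have "compact (closure ?A)" using bounded_annulus[of r R] by (simp add: compact_closure)
    then have "bounded (g ` closure ?A)" using that compact_continuous_image compact_imp_bounded by blast
    then obtain B where "\<forall>x\<in>closure ?A. \<bar>g x\<bar> \<le> B" by (auto simp: bounded_iff)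
    then have "\<forall>x\<in>?A. \<bar>g x\<bar> \<le> \<bar>B\<bar>" using closure_subset by fastforce
    then show ?thesis by (intro exI[of _ "\<bar>B\<bar>"]) auto
  qed
  obtain M where M: "\<forall>x\<in>?A. \<bar>u x\<bar> \<le> M" using bnd[OF C_holder_imp_continuous_on[OF Suc.prems]] by blast
  have "\<forall>i\<in>Basis. \<exists>B\<ge>0. \<forall>x\<in>?A. \<bar>G i x\<bar> \<le> B"
    using bnd G(2) C_holder_imp_continuous_on by blast
  from bchoice[OF this] obtain B where B: "\<And>i. i \<in> Basis \<Longrightarrow> 0 \<le> B i"
    "\<And>i x. i \<in> Basis \<Longrightarrow> x \<in> ?A \<Longrightarrow> \<bar>G i x\<bar> \<le> B i" by blast
  have "\<exists>L\<ge>0. \<forall>x\<in>?A. \<forall>y\<in>?A. \<bar>u x - u y\<bar> \<le> L * dist x y"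
  proof (rule lipschitz_on_annulus[OF assms(1,2)])
    show "onorm (\<lambda>h. \<Sum>i\<in>Basis. G i x * (h \<bullet> i)) \<le> (\<Sum>i\<in>Basis. B i)" if "x \<in> ?A" for x
    proof (rule onorm_le)
      fix h :: 'a
      have "norm (\<Sum>i\<in>Basis. G i x * (h \<bullet> i)) \<le> (\<Sum>i\<in>Basis. B i * norm h)"
        using B that Basis_le_norm by (intro sum_norm_le) (auto simp: abs_mult intro!: mult_mono)
      then show "norm (\<Sum>i\<in>Basis. G i x * (h \<bullet> i)) \<le> (\<Sum>i\<in>Basis. B i) * norm h"
        by (simp add: sum_distrib_right)
    qed
  qed (use G M in auto)
  then obtain L where "\<forall>x\<in>?A. \<forall>y\<in>?A. \<bar>u x - u y\<bar> \<le> L * dist x y" by blast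
  then have "hoelder_on 1 ?A u" by (auto simp: hoelder_on_def)
  then have "hoelder_on \<alpha> ?A u" using hoelder_on_exponent_mono bounded_annulus assms(3,4) by blast
  with G Suc.IH show ?case unfolding full_hoelder.simps by blast
qed

text \<open>
  A Hoelder continuous derivative is uniformly continuous and therefore extends to the closure.
\<close>

lemma full_hoelder_imp_C_holder:
  assumes "open S" "0 < \<alpha>"
  shows "full_hoelder k \<alpha> S u \<Longrightarrow> continuous_on (closure S) u \<Longrightarrow> C_holder k \<alpha> S u"
proof (induction k arbitrary: u)
  case 0
  then show ?case by (auto simp: hoelder_on_def)
next
  case (Suc k)
  obtain G where G: "\<forall>x\<in>S. (u has_derivative (\<lambda>h. \<Sum>i\<in>Basis. G i x * (h \<bullet> i))) (at x)"
    "\<forall>i\<in>Basis. full_hoelder k \<alpha> S (G i)" using Suc.prems by auto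
  have "\<exists>g. continuous_on (closure S) g \<and> (\<forall>x\<in>S. G i x = g x)" if i: "i \<in> Basis" for i
  proof -
    have "uniformly_continuous_on S (G i)"
      using full_hoelder_imp_hoelder_on G(2) i hoelder_on_imp_uniformly_continuous_on assms(2) by blast
    then obtain g where "uniformly_continuous_on (closure S) g" "\<And>x. x \<in> S \<Longrightarrow> G i x = g x"
      using uniformly_continuous_on_extension_on_closure by metis
    then show ?thesis using uniformly_continuous_imp_continuous by blast
  qed
  then have "\<forall>i\<in>Basis. \<exists>g. continuous_on (closure S) g \<and> (\<forall>x\<in>S. G i x = g x)" by blast
  from bchoice[OF this] obtain F where F: "\<And>i. i \<in> Basis \<Longrightarrow> continuous_on (closure S) (F i)"
    "\<And>i x. i \<in> Basis \<Longrightarrow> x \<in> S \<Longrightarrow> G i x = F i x" by blast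
  have "C_holder k \<alpha> S (F i)" if i: "i \<in> Basis" for i
    using full_hoelder_cong[of S "G i" "F i"] assms(1) F(2)[OF i] G(2) i F(1)[OF i] Suc.IH by blast
  moreover have "(u has_derivative (\<lambda>h. \<Sum>i\<in>Basis. F i x * (h \<bullet> i))) (at x)" if "x \<in> S" for x
  proof -
    have "(\<lambda>h. \<Sum>i\<in>Basis. G i x * (h \<bullet> i)) = (\<lambda>h. \<Sum>i\<in>Basis. F i x * (h \<bullet> i))"
      using F(2) that by (intro ext sum.cong) auto
    then show ?thesis using G(1)[rule_format, OF that]
      by (rule subst[where P = "\<lambda>D. (u has_derivative D) (at x)"])
  qed
  ultimately show ?case using Suc.prems(2) by auto
qed

section \<open>Laplacians\<close>

lemma partial_deriv_eq:
  assumes "(u has_derivative D) (at x)"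
  shows "partial_deriv i u x = D i"
proof -
  have "((\<lambda>t. x + t *\<^sub>R i) has_derivative (\<lambda>t. t *\<^sub>R i)) (at (0::real))"
    by (auto intro!: derivative_eq_intros)
  from has_derivative_compose[OF this, of u D] assms
  have "((\<lambda>t. u (x + t *\<^sub>R i)) has_derivative (\<lambda>t. D (t *\<^sub>R i))) (at 0)" by simp
  moreover have "(\<lambda>t. D (t *\<^sub>R i)) = (*) (D i)"
    using linear_cmul[OF has_derivative_linear[OF assms]] by (auto simp: mult.commute)
  ultimately have "((\<lambda>t. u (x + t *\<^sub>R i)) has_field_derivative D i) (at 0)"
    by (simp add: has_field_derivative_def)
  then show ?thesis unfolding partial_deriv_def by (rule DERIV_imp_deriv)
qed

lemma partial_deriv_cong:
  assumes "open S" "x \<in> S" "\<And>y. y \<in> S \<Longrightarrow> u y = v y"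
  shows "partial_deriv i u x = partial_deriv i v x"
proof -
  have "open ((\<lambda>t::real. x + t *\<^sub>R i) -` S)"
    by (intro open_vimage assms(1) continuous_intros)
  then have "\<forall>\<^sub>F t in nhds (0::real). x + t *\<^sub>R i \<in> S"
    using assms(2) eventually_nhds_in_open[of "(\<lambda>t::real. x + t *\<^sub>R i) -` S" 0] by simp
  then have "\<forall>\<^sub>F t in nhds (0::real). u (x + t *\<^sub>R i) = v (x + t *\<^sub>R i)"
    by (rule eventually_mono) (use assms(3) in auto)
  then show ?thesis unfolding partial_deriv_def by (intro deriv_cong_ev) auto
qed

lemma laplacian_cong:
  assumes "open S" "x \<in> S" "\<And>y. y \<in> S \<Longrightarrow> u y = v y"
  shows "laplacian u x = laplacian v x"
  unfolding laplacian_def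
  by (intro sum.cong refl partial_deriv_cong[OF assms(1,2)]) (rule partial_deriv_cong[OF assms(1)], use assms in auto)

lemma continuous_on_laplacian:
  assumes "open S" "0 < \<alpha>" "full_hoelder 2 \<alpha> S u"
  shows "continuous_on S (laplacian u)"
proof -
  obtain G where G: "\<forall>x\<in>S. (u has_derivative (\<lambda>h. \<Sum>i\<in>Basis. G i x * (h \<bullet> i))) (at x)"
    "\<forall>i\<in>Basis. full_hoelder 1 \<alpha> S (G i)" using assms(3) by (auto simp: numeral_2_eq_2)
  have "continuous_on S (partial_deriv i (partial_deriv i u))" if i: "i \<in> Basis" for i
  proof -
    obtain H where H: "\<forall>x\<in>S. (G i has_derivative (\<lambda>h. \<Sum>j\<in>Basis. H j x * (h \<bullet> j))) (at x)"
      "\<forall>j\<in>Basis. hoelder_on \<alpha> S (H j)" using G(2) i by (auto simp: One_nat_def)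
    have e1: "partial_deriv i u x = G i x" if "x \<in> S" for x
      using partial_deriv_eq[OF G(1)[rule_format, OF that], of i] i
      by (simp add: inner_Basis if_distrib cong: if_cong)
    have "partial_deriv i (partial_deriv i u) x = H i x" if x: "x \<in> S" for x
    proof -
      have "partial_deriv i (partial_deriv i u) x = partial_deriv i (G i) x"
        by (rule partial_deriv_cong[OF assms(1) x e1])
      also have "\<dots> = H i x"
        using partial_deriv_eq[OF H(1)[rule_format, OF x], of i] i
        by (simp add: inner_Basis if_distrib cong: if_cong)
      finally show ?thesis .
    qed
    moreover have "continuous_on S (H i)"
      using H(2) i hoelder_on_imp_uniformly_continuous_on[OF _ assms(2)] uniformly_continuous_imp_continuous by blast
    ultimately show ?thesis by (metis continuous_on_eq)
  qed
  then show ?thesis unfolding laplacian_def by (intro continuous_on_sum) auto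
qed

text \<open>
  The chain rule for a function of two scalar quantities A and B with gradients a and b.  The sums
  over the basis are the traces of the derivatives of a and b, that is, the Laplacians of A and B.
\<close>

lemma laplacian_function_of_two:
  fixes A B :: "'a::euclidean_space \<Rightarrow> real"
  assumes V: "\<And>w. w \<in> W \<Longrightarrow> (V has_derivative (\<lambda>h. V1 w * fst h + V2 w * snd h)) (at w)"
    and V1: "(V1 has_derivative (\<lambda>h. V11 * fst h + V12 * snd h)) (at (A x, B x))"
    and V2: "(V2 has_derivative (\<lambda>h. V21 * fst h + V22 * snd h)) (at (A x, B x))"
    and U: "open U" "x \<in> U" "\<And>y. y \<in> U \<Longrightarrow> (A y, B y) \<in> W"
    and A: "\<And>y. y \<in> U \<Longrightarrow> (A has_derivative (\<lambda>h. a y \<bullet> h)) (at y)"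
    and B: "\<And>y. y \<in> U \<Longrightarrow> (B has_derivative (\<lambda>h. b y \<bullet> h)) (at y)"
    and a: "(a has_derivative a') (at x)" and b: "(b has_derivative b') (at x)"
  shows "laplacian (\<lambda>y. V (A y, B y)) x =
    V11 * (a x \<bullet> a x) + (V12 + V21) * (a x \<bullet> b x) + V22 * (b x \<bullet> b x)
    + V1 (A x, B x) * (\<Sum>i\<in>Basis. a' i \<bullet> i) + V2 (A x, B x) * (\<Sum>i\<in>Basis. b' i \<bullet> i)"
proof -
  let ?w = "\<lambda>y. (A y, B y)"
  have w: "(?w has_derivative (\<lambda>h. (a y \<bullet> h, b y \<bullet> h))) (at y)" if "y \<in> U" for y
    using A B that by (intro has_derivative_Pair) auto
  have second: "partial_deriv i (partial_deriv i (\<lambda>y. V (?w y))) x =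
      V11 * ((a x \<bullet> i) * (a x \<bullet> i)) + (V12 + V21) * ((a x \<bullet> i) * (b x \<bullet> i)) + V22 * ((b x \<bullet> i) * (b x \<bullet> i))
      + V1 (?w x) * (a' i \<bullet> i) + V2 (?w x) * (b' i \<bullet> i)" for i
  proof -
    have "partial_deriv i (partial_deriv i (\<lambda>y. V (?w y))) x
        = partial_deriv i (\<lambda>y. V1 (?w y) * (a y \<bullet> i) + V2 (?w y) * (b y \<bullet> i)) x"
    proof (rule partial_deriv_cong[OF U(1,2)])
      fix y assume y: "y \<in> U"
      show "partial_deriv i (\<lambda>y. V (?w y)) y = V1 (?w y) * (a y \<bullet> i) + V2 (?w y) * (b y \<bullet> i)"
        using partial_deriv_eq[OF has_derivative_compose[OF w[OF y] V[OF U(3)[OF y]]], of i] by simp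
    qed
    also have "\<dots> = V1 (?w x) * (a' i \<bullet> i) + (V11 * (a x \<bullet> i) + V12 * (b x \<bullet> i)) * (a x \<bullet> i)
        + (V2 (?w x) * (b' i \<bullet> i) + (V21 * (a x \<bullet> i) + V22 * (b x \<bullet> i)) * (b x \<bullet> i))"
    proof (rule partial_deriv_eq[THEN trans])
      have "((\<lambda>y. V1 (?w y)) has_derivative (\<lambda>h. V11 * (a x \<bullet> h) + V12 * (b x \<bullet> h))) (at x)"
        using has_derivative_compose[OF w[OF U(2)] V1] by simp
      moreover have "((\<lambda>y. V2 (?w y)) has_derivative (\<lambda>h. V21 * (a x \<bullet> h) + V22 * (b x \<bullet> h))) (at x)"
        using has_derivative_compose[OF w[OF U(2)] V2] by simp
      ultimately show "((\<lambda>y. V1 (?w y) * (a y \<bullet> i) + V2 (?w y) * (b y \<bullet> i)) has_derivative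
        (\<lambda>h. V1 (?w x) * (a' h \<bullet> i) + (V11 * (a x \<bullet> h) + V12 * (b x \<bullet> h)) * (a x \<bullet> i)
        + (V2 (?w x) * (b' h \<bullet> i) + (V21 * (a x \<bullet> h) + V22 * (b x \<bullet> h)) * (b x \<bullet> i)))) (at x)"
        by (intro has_derivative_add has_derivative_mult has_derivative_inner_left a b)
    qed simp
    finally show ?thesis by (simp add: algebra_simps)
  qed
  show ?thesis
    unfolding laplacian_def second
    by (simp add: sum.distrib sum_distrib_left[symmetric] flip: euclidean_inner)
qed

section \<open>Norms and powers as smooth functions\<close>

lemma full_hoelder_inner_self:
  fixes L :: "'a::euclidean_space \<Rightarrow> 'b::euclidean_space"
  assumes "bounded_linear L" "bounded T"
  shows "full_hoelder k 1 T (\<lambda>x. L x \<bullet> L x)"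
proof -
  have "full_hoelder k 1 T (\<lambda>x. \<Sum>i\<in>Basis. (L x \<bullet> i) * (L x \<bullet> i))"
    by (intro full_hoelder_sum full_hoelder_mult full_hoelder_bounded_linear
        bounded_linear_compose[OF bounded_linear_inner_left assms(1)] assms(2)) auto
  then show ?thesis by (simp flip: euclidean_inner)
qed

text \<open>
  Square roots and their reciprocals, which make up the charts below, are powers of functions that
  are bounded away from 0.
\<close>

lemma full_hoelder_powr_compose:
  assumes "bounded T" "full_hoelder k 1 T g" "0 < c" "\<And>x. x \<in> T \<Longrightarrow> c < g x"
  shows "full_hoelder k 1 T (\<lambda>x. g x powr r)"
proof -
  obtain C where C: "\<And>x. x \<in> T \<Longrightarrow> \<bar>g x\<bar> \<le> C"
    using hoelder_on_bounded[OF full_hoelder_imp_hoelder_on[OF assms(2)] assms(1)] by auto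
  show ?thesis
  proof (rule full_hoelder_compose[where u = "\<lambda>x. x powr r" and \<phi> = g, OF assms(1)])
    show "full_hoelder k 1 {c<..<C + 1} (\<lambda>x. x powr r)" by (rule full_hoelder_powr[OF assms(3)])
    show "g ` T \<subseteq> {c<..<C + 1}" using C assms(4) by fastforce
  qed (use assms(2) in auto)
qed

lemma full_hoelder_norm:
  fixes L :: "'a::euclidean_space \<Rightarrow> 'b::euclidean_space"
  assumes "bounded_linear L" "bounded T" "0 < c" "\<And>x. x \<in> T \<Longrightarrow> c < norm (L x)"
  shows "full_hoelder k 1 T (\<lambda>x. norm (L x))"
proof -
  have "full_hoelder k 1 T (\<lambda>x. (L x \<bullet> L x) powr (1 / 2))"
  proof (rule full_hoelder_powr_compose[OF assms(2) full_hoelder_inner_self[OF assms(1,2)]])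
    show "0 < c\<^sup>2" using assms(3) by simp
    show "c\<^sup>2 < L x \<bullet> L x" if "x \<in> T" for x
      using assms(3) assms(4)[OF that] by (simp add: dot_square_norm power_strict_mono)
  qed
  then show ?thesis by (simp add: powr_half_sqrt norm_eq_sqrt_inner)
qed

section \<open>Symmetry as invariance\<close>

text \<open>
  Replaces the existence of a profile function by invariance, the form that can be transported
  along maps.
\<close>

lemma function_of_two_iff:
  "(\<exists>w. \<forall>x\<in>S. u x = w (f x) (g x)) \<longleftrightarrow>
   (\<forall>x\<in>S. \<forall>y\<in>S. f x = f y \<longrightarrow> g x = g y \<longrightarrow> u x = u y)"
proof
  assume R: "\<forall>x\<in>S. \<forall>y\<in>S. f x = f y \<longrightarrow> g x = g y \<longrightarrow> u x = u y"
  define w where "w = (\<lambda>s t. u (SOME y. y \<in> S \<and> f y = s \<and> g y = t))"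
  have "u x = w (f x) (g x)" if x: "x \<in> S" for x
  proof -
    have "(SOME y. y \<in> S \<and> f y = f x \<and> g y = g x) \<in> S \<and> f (SOME y. y \<in> S \<and> f y = f x \<and> g y = g x) = f x
      \<and> g (SOME y. y \<in> S \<and> f y = f x \<and> g y = g x) = g x"
      using x by (intro someI[of "\<lambda>y. y \<in> S \<and> f y = f x \<and> g y = g x" x]) auto
    then show ?thesis using R x unfolding w_def by metis
  qed
  then show "\<exists>w. \<forall>x\<in>S. u x = w (f x) (g x)" by blast
qed metis

text \<open>
  As \<open>arccos\<close> is injective on the interval from - 1 to 1, the angle with p and the norm determine
  the component along p, and conversely.
\<close>

lemma axially_symmetric_on_iff:
  fixes p :: "'a::euclidean_space"
  assumes "norm p = 1" "0 \<notin> S"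
  shows "axially_symmetric_on S p v \<longleftrightarrow>
    (\<forall>z\<in>S. \<forall>y\<in>S. norm z = norm y \<longrightarrow> z \<bullet> p = y \<bullet> p \<longrightarrow> v z = v y)"
proof -
  have "arccos ((z /\<^sub>R norm z) \<bullet> p) = arccos ((y /\<^sub>R norm y) \<bullet> p) \<longleftrightarrow> z \<bullet> p = y \<bullet> p"
    if zy: "z \<in> S" "y \<in> S" "norm z = norm y" for z y
  proof -
    have z: "z \<noteq> 0" "y \<noteq> 0" using zy assms(2) by auto
    have le: "\<bar>(w /\<^sub>R norm w) \<bullet> p\<bar> \<le> 1" if "w \<noteq> 0" for w
      using Cauchy_Schwarz_ineq2[of "w /\<^sub>R norm w" p] that assms(1) by simp
    show ?thesis using arccos_eq_iff[of "(z /\<^sub>R norm z) \<bullet> p" "(y /\<^sub>R norm y) \<bullet> p"] le[OF z(1)] le[OF z(2)] z zy(3)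
      by simp
  qed
  then show ?thesis unfolding axially_symmetric_on_def function_of_two_iff by blast
qed

section \<open>Boundary conditions under homogeneous maps\<close>

lemma boundary_point_along_normal:
  fixes x :: "'a::euclidean_space"
  assumes "0 < r" "r < R" "x \<in> frontier (annulus r R)"
  obtains \<epsilon> :: real where "\<epsilon> = (if norm x = R then 1 else - 1)" "annulus_normal R x = \<epsilon> *\<^sub>R sgn x"
    "\<And>t. x + t *\<^sub>R annulus_normal R x = (1 + \<epsilon> * t / norm x) *\<^sub>R x"
    "\<And>t. - (R - r) < t \<Longrightarrow> t \<le> 0 \<Longrightarrow> x + t *\<^sub>R annulus_normal R x \<in> closure (annulus r R)"
proof
  let ?e = "if norm x = R then 1 else - 1 :: real"
  have x: "norm x = r \<or> norm x = R" using assms(3) frontier_annulus[OF assms(1,2)] by blast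
  then have x0: "norm x > 0" using assms(1,2) by linarith
  show "annulus_normal R x = ?e *\<^sub>R sgn x" by (simp add: annulus_normal_def)
  then show *: "x + t *\<^sub>R annulus_normal R x = (1 + ?e * t / norm x) *\<^sub>R x" for t
    by (simp add: sgn_div_norm algebra_simps divide_inverse)
  show "x + t *\<^sub>R annulus_normal R x \<in> closure (annulus r R)" if t: "- (R - r) < t" "t \<le> 0" for t
  proof -
    have "norm (x + t *\<^sub>R annulus_normal R x) = \<bar>(1 + ?e * t / norm x) * norm x\<bar>"
      unfolding * by (simp add: abs_mult)
    also have "(1 + ?e * t / norm x) * norm x = norm x + ?e * t" using x0 by (simp add: field_simps)
    finally have "norm (x + t *\<^sub>R annulus_normal R x) = \<bar>norm x + ?e * t\<bar>" .
    moreover have "r \<le> norm x + ?e * t \<and> norm x + ?e * t \<le> R" using x t assms(1,2) by auto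
    ultimately show ?thesis unfolding closure_annulus[OF assms(1,2)] using assms(1) by simp
  qed
qed simp

text \<open>
  A one-sided chain rule in one variable: the increasing substitution s maps a left
  neighbourhood of 0 to a left neighbourhood of 0.
\<close>

lemma has_normal_derivative_reparametrise:
  assumes F: "has_normal_derivative F 0 n x"
    and s: "(s has_real_derivative c) (at 0)" "0 < c" "s 0 = 0"
    and G: "\<forall>\<^sub>F t in at_left 0. G (z + t *\<^sub>R m) = F (x + s t *\<^sub>R n)" "G z = F x"
  shows "has_normal_derivative G 0 m z"
proof -
  define f where "f = (\<lambda>t. F (x + t *\<^sub>R n))"
  obtain d where d: "0 < d" "\<And>h. 0 < h \<Longrightarrow> h < d \<Longrightarrow> s (0 - h) < s 0"
    using DERIV_pos_inc_left[OF s(1,2)] by blast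
  let ?T = "{- d<..<0}"
  have neg: "s t < 0" if "t \<in> ?T" for t using d(2)[of "- t"] that s(3) by auto
  have at: "at_left 0 = at 0 within ?T"
    using d(1) by (intro at_within_nhd[of 0 "{- d<..<d}"]) auto
  have "(f has_real_derivative 0) (at (s 0) within s ` ?T)"
    using F neg unfolding has_normal_derivative_def f_def s(3)
    by (rule_tac has_field_derivative_subset[where s = "{..<0}"]) auto
  moreover have "(s has_real_derivative c) (at 0 within ?T)"
    using s(1) by (rule has_field_derivative_at_within)
  ultimately have "((f \<circ> s) has_real_derivative 0) (at_left 0)"
    using DERIV_image_chain[of f 0 s 0 ?T c] unfolding at by simp
  then have "((\<lambda>t. (f (s t) - f (s 0)) / (t - 0)) \<longlongrightarrow> 0) (at_left 0)"
    by (simp add: has_field_derivative_iff)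
  moreover have "\<forall>\<^sub>F t in at_left 0. (f (s t) - f (s 0)) / (t - 0) = (G (z + t *\<^sub>R m) - G (z + 0 *\<^sub>R m)) / (t - 0)"
    using G(1) by eventually_elim (simp add: f_def s(3) G(2))
  ultimately have "((\<lambda>t. (G (z + t *\<^sub>R m) - G (z + 0 *\<^sub>R m)) / (t - 0)) \<longlongrightarrow> 0) (at_left 0)"
    by (rule Lim_transform_eventually)
  then show ?thesis unfolding has_normal_derivative_def has_field_derivative_iff .
qed

text \<open>
  A positively homogeneous map sends radial segments to radial segments, and normals of annuli are
  radial; so the normal derivatives are related by a one-variable substitution with positive speed.
  The sign \<open>\<epsilon>\<close> in the proof distinguishes the outer from the inner sphere.
\<close>

lemma boundary_condition_pullback:
  fixes \<Phi> :: "'a::euclidean_space \<Rightarrow> 'b::euclidean_space"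
  assumes r: "0 < r" "r < R" and r': "0 < r'" "r' < R'" and \<beta>: "0 < \<beta>"
    and hom: "\<And>l x. 0 < l \<Longrightarrow> \<Phi> (l *\<^sub>R x) = (l powr \<beta>) *\<^sub>R \<Phi> x"
    and inner: "\<And>x. norm x = r \<Longrightarrow> norm (\<Phi> x) = r'"
    and outer: "\<And>x. norm x = R \<Longrightarrow> norm (\<Phi> x) = R'"
    and u: "\<And>x. x \<in> closure (annulus r R) \<Longrightarrow> u x = v (\<Phi> x)"
    and v: "boundary_condition bc r' R' v"
  shows "boundary_condition bc r R u"
proof -
  have fr: "\<Phi> x \<in> frontier (annulus r' R')" "x \<in> closure (annulus r R)" if "x \<in> frontier (annulus r R)" for x
    using that inner[of x] outer[of x] frontier_annulus[OF r, where 'a = 'a] frontier_annulus[OF r', where 'a = 'b]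
    by (auto simp: frontier_def)
  show ?thesis
  proof (cases bc)
    case Dirichlet
    then show ?thesis using v fr u by simp
  next
    case Neumann
    have "has_normal_derivative u 0 (annulus_normal R x) x" if x: "x \<in> frontier (annulus r R)" for x
    proof -
      let ?y = "\<Phi> x"
      obtain \<epsilon> :: real where e: "\<epsilon> = (if norm x = R then 1 else - 1)"
        "\<And>t. x + t *\<^sub>R annulus_normal R x = (1 + \<epsilon> * t / norm x) *\<^sub>R x"
        "\<And>t. - (R - r) < t \<Longrightarrow> t \<le> 0 \<Longrightarrow> x + t *\<^sub>R annulus_normal R x \<in> closure (annulus r R)"
        using boundary_point_along_normal[OF r x] by metis
      obtain \<epsilon>' :: real where e': "\<epsilon>' = (if norm ?y = R' then 1 else - 1)"
        "\<And>t. ?y + t *\<^sub>R annulus_normal R' ?y = (1 + \<epsilon>' * t / norm ?y) *\<^sub>R ?y"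
        using boundary_point_along_normal[OF r' fr(1)[OF x]] by metis
      have nx: "norm x = r \<or> norm x = R" using x frontier_annulus[OF r] by blast
      then have ee: "\<epsilon>' = \<epsilon>" unfolding e(1) e'(1) using inner[of x] outer[of x] r r' by auto
      have e2: "\<epsilon> * \<epsilon> = 1" by (simp add: e(1))
      have pos: "0 < norm x" "0 < norm ?y" using nx inner[of x] outer[of x] r r' by auto
      define s where "s = (\<lambda>t. \<epsilon> * norm ?y * ((1 + \<epsilon> * t / norm x) powr \<beta> - 1))"
      show ?thesis
      proof (rule has_normal_derivative_reparametrise)
        show "has_normal_derivative v 0 (annulus_normal R' ?y) ?y" using v Neumann fr(1)[OF x] by simp
        have "(s has_real_derivative (\<epsilon> * \<epsilon>) * norm ?y * \<beta> / norm x) (at 0)"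
          unfolding s_def using pos by (auto intro!: derivative_eq_intros)
        then show "(s has_real_derivative norm ?y * \<beta> / norm x) (at 0)" using e2 by simp
        show "0 < norm ?y * \<beta> / norm x" using pos \<beta> by simp
        show "s 0 = 0" by (simp add: s_def)
        show "u x = v ?y" using u fr(2)[OF x] by blast
        have "\<forall>\<^sub>F t in at_left 0. t \<in> {- min (R - r) (norm x)<..<0::real}"
          by (rule eventually_at_left_real) (use r pos in auto)
        then show "\<forall>\<^sub>F t in at_left 0. u (x + t *\<^sub>R annulus_normal R x) = v (?y + s t *\<^sub>R annulus_normal R' ?y)"
        proof eventually_elim
          case (elim t)
          have l: "0 < 1 + \<epsilon> * t / norm x" using elim pos by (auto simp: e(1) field_simps)
          have "1 + \<epsilon>' * s t / norm ?y = 1 + (\<epsilon> * \<epsilon>) * ((1 + \<epsilon> * t / norm x) powr \<beta> - 1)"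
            unfolding s_def ee using pos by (simp add: field_simps)
          also have "\<dots> = (1 + \<epsilon> * t / norm x) powr \<beta>" using e2 by simp
          finally have "?y + s t *\<^sub>R annulus_normal R' ?y = \<Phi> ((1 + \<epsilon> * t / norm x) *\<^sub>R x)"
            unfolding e'(2) hom[OF l] by simp
          moreover have "x + t *\<^sub>R annulus_normal R x \<in> closure (annulus r R)"
            using elim by (intro e(3)) auto
          ultimately show ?case using u[of "x + t *\<^sub>R annulus_normal R x"] unfolding e(2) by simp
        qed
      qed
    qed
    then show ?thesis using Neumann by simp
  qed
qed

section \<open>Auxiliary facts on products and density\<close>

lemma sum_Basis_prod:
  fixes f :: "('a::euclidean_space \<times> 'b::euclidean_space) \<Rightarrow> 'c::comm_monoid_add"
  shows "(\<Sum>i\<in>Basis. f i) = (\<Sum>i\<in>Basis. f (i, 0)) + (\<Sum>i\<in>Basis. f (0, i))"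
proof -
  have "inj_on (\<lambda>u. (u::'a, 0::'b)) Basis" "inj_on (\<lambda>u. (0::'a, u::'b)) Basis"
    by (auto intro!: inj_onI)
  then show ?thesis
    unfolding Basis_prod_def by (subst sum.union_disjoint) (auto simp: sum.reindex)
qed

lemma nonzero_components_dense:
  fixes U :: "('b::euclidean_space \<times> 'b) set"
  assumes "open U" "U \<noteq> {}"
  shows "\<exists>x\<in>U. fst x \<noteq> 0 \<and> snd x \<noteq> 0"
proof -
  obtain x where "x \<in> U" using assms(2) by blast
  then obtain A B where AB: "open A" "open B" "A \<times> B \<subseteq> U" "x \<in> A \<times> B"
    using open_prod_elim[OF assms(1)] by metis
  have "\<exists>y\<in>C. y \<noteq> 0" if "open C" "C \<noteq> {}" for C :: "'b set"
    using that not_open_singleton[of "0::'b"] by (metis singletonI subset_singletonD subsetI)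
  then obtain y z where "y \<in> A" "y \<noteq> 0" "z \<in> B" "z \<noteq> 0" using AB by (metis SigmaE empty_iff)
  then show ?thesis using AB(3) by (intro bexI[of _ "(y, z)"]) auto
qed

lemma full_hoelder_2_partials:
  fixes V :: "real \<times> real \<Rightarrow> real"
  assumes "full_hoelder 2 \<alpha> W V" "w0 \<in> W"
  shows "\<exists>V1 V2 V11 V12 V21 V22.
    (\<forall>w\<in>W. (V has_derivative (\<lambda>h. V1 w * fst h + V2 w * snd h)) (at w)) \<and>
    (V1 has_derivative (\<lambda>h. V11 * fst h + V12 * snd h)) (at w0) \<and>
    (V2 has_derivative (\<lambda>h. V21 * fst h + V22 * snd h)) (at w0)"
proof -
  have sum: "(\<Sum>i\<in>Basis. g i * (h \<bullet> i)) = g (1, 0) * fst h + g (0, 1) * snd h"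
    for g and h :: "real \<times> real"
    by (subst sum_Basis_prod) (simp add: inner_prod_def)
  obtain G where G: "\<forall>x\<in>W. (V has_derivative (\<lambda>h. \<Sum>i\<in>Basis. G i x * (h \<bullet> i))) (at x)"
    "\<forall>i\<in>Basis. full_hoelder 1 \<alpha> W (G i)" using assms(1) by (auto simp: numeral_2_eq_2)
  have B: "(1, 0) \<in> (Basis :: (real \<times> real) set)" "(0, 1) \<in> (Basis :: (real \<times> real) set)"
    by (auto simp: Basis_prod_def)
  obtain H1 where H1: "\<forall>x\<in>W. (G (1, 0) has_derivative (\<lambda>h. \<Sum>j\<in>Basis. H1 j x * (h \<bullet> j))) (at x)"
    using G(2) B(1) by (auto simp: One_nat_def simp del: One_nat_def[symmetric])
  obtain H2 where H2: "\<forall>x\<in>W. (G (0, 1) has_derivative (\<lambda>h. \<Sum>j\<in>Basis. H2 j x * (h \<bullet> j))) (at x)"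
    using G(2) B(2) by (auto simp: One_nat_def simp del: One_nat_def[symmetric])
  have "\<forall>w\<in>W. (V has_derivative (\<lambda>h. G (1, 0) w * fst h + G (0, 1) w * snd h)) (at w)"
    using G(1) unfolding sum .
  moreover have "(G (1, 0) has_derivative (\<lambda>h. H1 (1, 0) w0 * fst h + H1 (0, 1) w0 * snd h)) (at w0)"
    using H1 assms(2) unfolding sum by blast
  moreover have "(G (0, 1) has_derivative (\<lambda>h. H2 (1, 0) w0 * fst h + H2 (0, 1) w0 * snd h)) (at w0)"
    using H2 assms(2) unfolding sum by blast
  ultimately show ?thesis by blast
qed

text \<open>
  The set where F does not vanish is open, so it is empty if F has a zero in every nonempty open
  subset of S.
\<close>

lemma continuous_zero_from_dense:
  fixes F :: "'d::topological_space \<Rightarrow> real"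
  assumes "open S" "continuous_on S F" "x \<in> S"
    and dense: "\<And>U. open U \<Longrightarrow> U \<noteq> {} \<Longrightarrow> U \<subseteq> S \<Longrightarrow> \<exists>y\<in>U. F y = 0"
  shows "F x = 0"
proof (rule ccontr)
  assume "F x \<noteq> 0"
  then have "x \<in> S \<inter> F -` (- {0})" using assms(3) by auto
  moreover have "open (S \<inter> F -` (- {0}))" by (intro continuous_open_preimage assms) auto
  ultimately show False using dense[of "S \<inter> F -` (- {0})"] by blast
qed

section \<open>The doubling map and its inverse\<close>

text \<open>
  A Euclidean space \<open>'c\<close> with an axis p, and a Euclidean space \<open>'b\<close> of one
  dimension less, which J embeds isometrically as the hyperplane orthogonal to p.  The map K stands for the
  orthogonal projection to that hyperplane, read in \<open>'b\<close>; only its linearity and the norms of its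
  values enter.  The unit vectors q (orthogonal to p) and e select
  one point on each orbit of the rotations about p and of the rotations of \<open>'b\<close>.
\<close>

locale annulus_correspondence =
  fixes a b \<alpha> :: real and p q :: "'c::euclidean_space" and e :: "'b::euclidean_space"
    and J :: "'b \<Rightarrow> 'c" and K :: "'c \<Rightarrow> 'b"
  assumes a: "0 < a" and ab: "a < b" and \<alpha>: "0 < \<alpha>" "\<alpha> \<le> 1"
    and p: "norm p = 1" and q: "norm q = 1" "q \<bullet> p = 0" and e: "norm e = 1"
    and J: "linear J" "\<And>y. norm (J y) = norm y" "\<And>y. J y \<bullet> p = 0"
    and K: "linear K" "\<And>z. (norm (K z))\<^sup>2 = (norm z)\<^sup>2 - (z \<bullet> p)\<^sup>2"
    and dim: "DIM('c) = DIM('b) + 1"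
begin

abbreviation A :: "('b \<times> 'b) set" where "A \<equiv> annulus a b"
abbreviation D :: "'c set" where "D \<equiv> annulus (a\<^sup>2 / 2) (b\<^sup>2 / 2)"

definition height :: "'b \<times> 'b \<Rightarrow> real" where
  "height x = (fst x \<bullet> fst x - snd x \<bullet> snd x) / 2"

text \<open>
  If \<open>norm (fst x) = r cos \<theta>\<close> and \<open>norm (snd x) = r sin \<theta>\<close>, then
  \<open>\<tau> x\<close> has norm \<open>r\<^sup>2 / 2\<close> and angle \<open>2 \<theta>\<close> with the axis p: in these
  coordinates \<open>\<tau>\<close> is half of the complex square.  The map \<open>\<sigma>\<close> is the corresponding square root.
\<close>

definition \<tau> :: "'b \<times> 'b \<Rightarrow> 'c" where
  "\<tau> x = height x *\<^sub>R p + (norm (fst x) * norm (snd x)) *\<^sub>R q"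

definition \<sigma> :: "'c \<Rightarrow> 'b \<times> 'b" where
  "\<sigma> z = (sqrt (norm z + z \<bullet> p) *\<^sub>R e, sqrt (norm z - z \<bullet> p) *\<^sub>R e)"

definition symA :: "('b \<times> 'b \<Rightarrow> real) \<Rightarrow> bool" where
  "symA u \<longleftrightarrow> (\<forall>x\<in>closure A. \<forall>y\<in>closure A.
     norm (fst x) = norm (fst y) \<longrightarrow> norm (snd x) = norm (snd y) \<longrightarrow> u x = u y)"

definition symD :: "('c \<Rightarrow> real) \<Rightarrow> bool" where
  "symD v \<longleftrightarrow> (\<forall>z\<in>closure D. \<forall>y\<in>closure D.
     norm z = norm y \<longrightarrow> z \<bullet> p = y \<bullet> p \<longrightarrow> v z = v y)"

lemma radii: "0 < a\<^sup>2 / 2" "a\<^sup>2 / 2 < b\<^sup>2 / 2"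
  using a ab by (auto intro: power_strict_mono)

lemma pp: "p \<bullet> p = 1" and qq: "q \<bullet> q = 1"
  using p q by (simp_all add: dot_square_norm)

lemma norm_sq_components: "(norm x)\<^sup>2 = (norm (fst x))\<^sup>2 + (norm (snd x))\<^sup>2" for x :: "'b \<times> 'b"
  by (simp add: norm_prod_def)

lemma abs_inner_p_le: "\<bar>z \<bullet> p\<bar> \<le> norm z"
  using Cauchy_Schwarz_ineq2[of z p] p by simp

lemma norm_height_point:
  assumes "w \<bullet> p = 0" "norm w = norm (fst x) * norm (snd x)"
  shows "norm (height x *\<^sub>R p + w) = (norm x)\<^sup>2 / 2" "(height x *\<^sub>R p + w) \<bullet> p = height x"
proof -
  have "(norm (height x *\<^sub>R p + w))\<^sup>2 = (height x)\<^sup>2 + (norm w)\<^sup>2"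
    unfolding power2_norm_eq_inner using assms(1) pp
    by (simp add: inner_add_left inner_add_right inner_commute[of p w] power2_eq_square)
  also have "\<dots> = ((norm x)\<^sup>2 / 2)\<^sup>2"
    unfolding assms(2) height_def norm_sq_components dot_square_norm by (simp add: power2_eq_square field_simps)
  finally show "norm (height x *\<^sub>R p + w) = (norm x)\<^sup>2 / 2" by (simp add: power2_eq_iff_nonneg)
  show "(height x *\<^sub>R p + w) \<bullet> p = height x" using assms(1) pp by (simp add: inner_add_left)
qed

lemma norm_\<tau>: "norm (\<tau> x) = (norm x)\<^sup>2 / 2" and \<tau>_inner_p: "\<tau> x \<bullet> p = height x"
  unfolding \<tau>_def using norm_height_point[of "(norm (fst x) * norm (snd x)) *\<^sub>R q" x] q by simp_all

lemma norm_fst_\<sigma>: "norm (fst (\<sigma> z)) = sqrt (norm z + z \<bullet> p)"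
  and norm_snd_\<sigma>: "norm (snd (\<sigma> z)) = sqrt (norm z - z \<bullet> p)"
  using abs_inner_p_le[of z] e by (simp_all add: \<sigma>_def)

lemma norm_and_height_from_radii:
  assumes "norm (fst x) = sqrt (norm z + z \<bullet> p)" "norm (snd x) = sqrt (norm z - z \<bullet> p)"
  shows "(norm x)\<^sup>2 = 2 * norm z" "height x = z \<bullet> p"
  using assms abs_inner_p_le[of z] by (auto simp: norm_sq_components height_def dot_square_norm)

lemma norm_\<sigma>: "(norm (\<sigma> z))\<^sup>2 = 2 * norm z"
  by (rule norm_and_height_from_radii[OF norm_fst_\<sigma> norm_snd_\<sigma>])

lemma annulus_iff:
  assumes "norm z = (norm x)\<^sup>2 / 2"
  shows "z \<in> D \<longleftrightarrow> x \<in> A" "z \<in> closure D \<longleftrightarrow> x \<in> closure A"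
proof -
  have "a < norm x \<longleftrightarrow> a\<^sup>2 < (norm x)\<^sup>2" "norm x < b \<longleftrightarrow> (norm x)\<^sup>2 < b\<^sup>2"
    using a ab by (auto intro: power_strict_mono power_less_imp_less_base[of _ 2])
  moreover have "a \<le> norm x \<longleftrightarrow> a\<^sup>2 \<le> (norm x)\<^sup>2" "norm x \<le> b \<longleftrightarrow> (norm x)\<^sup>2 \<le> b\<^sup>2"
    using a ab by (auto intro: power_mono power2_le_imp_le)
  ultimately show "z \<in> D \<longleftrightarrow> x \<in> A" "z \<in> closure D \<longleftrightarrow> x \<in> closure A"
    unfolding closure_annulus[OF a ab] closure_annulus[OF radii] by (auto simp: annulus_def assms)
qed

lemma \<tau>_in: "\<tau> x \<in> D \<longleftrightarrow> x \<in> A" "\<tau> x \<in> closure D \<longleftrightarrow> x \<in> closure A"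
  using annulus_iff[OF norm_\<tau>] by auto

lemma \<sigma>_in: "\<sigma> z \<in> A \<longleftrightarrow> z \<in> D" "\<sigma> z \<in> closure A \<longleftrightarrow> z \<in> closure D"
  using annulus_iff[of z "\<sigma> z"] norm_\<sigma> by auto

text \<open>
  The maps \<open>\<tau>\<close> and \<open>\<sigma>\<close> are inverse to each other up to rotations, which symmetric functions
  do not see.
\<close>

lemma \<tau>_\<sigma>: "norm (\<tau> (\<sigma> z)) = norm z" "\<tau> (\<sigma> z) \<bullet> p = z \<bullet> p"
  using norm_\<tau>[of "\<sigma> z"] norm_\<sigma>[of z] \<tau>_inner_p[of "\<sigma> z"] norm_and_height_from_radii[OF norm_fst_\<sigma> norm_snd_\<sigma>] by auto

lemma \<sigma>_\<tau>: "norm (fst (\<sigma> (\<tau> x))) = norm (fst x)" "norm (snd (\<sigma> (\<tau> x))) = norm (snd x)"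
  unfolding norm_fst_\<sigma> norm_snd_\<sigma> norm_\<tau> \<tau>_inner_p
  by (simp_all add: norm_sq_components height_def dot_square_norm field_simps)

lemma continuous_on_\<tau>: "continuous_on S \<tau>"
  unfolding \<tau>_def height_def by (intro continuous_intros) auto

lemma continuous_on_\<sigma>: "continuous_on S \<sigma>"
  unfolding \<sigma>_def by (intro continuous_intros)

lemma \<tau>_scaleR: "0 < l \<Longrightarrow> \<tau> (l *\<^sub>R x) = (l powr 2) *\<^sub>R \<tau> x"
  by (simp add: \<tau>_def height_def scaleR_add_right power2_eq_square algebra_simps diff_divide_distrib)

lemma \<sigma>_scaleR: "0 < l \<Longrightarrow> \<sigma> (l *\<^sub>R z) = (l powr (1 / 2)) *\<^sub>R \<sigma> z"
  by (simp add: \<sigma>_def powr_half_sqrt flip: distrib_left right_diff_distrib real_sqrt_mult)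

lemma sym_restrict:
  "symA (restrict u (closure A)) \<longleftrightarrow> symA u" "symD (restrict v (closure D)) \<longleftrightarrow> symD v"
  unfolding symA_def symD_def by (simp_all cong: ball_cong)

section \<open>Regularity of the pullbacks\<close>

text \<open>
  For a symmetric v the direction q in \<open>\<tau>\<close> may be replaced by any other direction orthogonal
  to p, even one that depends on x.
\<close>

lemma symD_eq:
  assumes "symD v" "x \<in> closure A" "w \<bullet> p = 0" "norm w = norm (fst x) * norm (snd x)"
  shows "v (\<tau> x) = v (height x *\<^sub>R p + w)"
proof -
  have "height x *\<^sub>R p + w \<in> closure D"
    using annulus_iff(2)[OF norm_height_point(1)[OF assms(3,4)]] assms(2) by blast
  then show ?thesis
    using assms(1,2) \<tau>_in(2) norm_\<tau> \<tau>_inner_p norm_height_point[OF assms(3,4)] unfolding symD_def by metis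
qed

lemma symA_eq:
  assumes "symA u" "z \<in> closure D" "norm (fst x) = sqrt (norm z + z \<bullet> p)" "norm (snd x) = sqrt (norm z - z \<bullet> p)"
  shows "u (\<sigma> z) = u x"
proof -
  have "x \<in> closure A"
    using annulus_iff(2)[of z x] norm_and_height_from_radii(1)[OF assms(3,4)] assms(2) by simp
  then show ?thesis using assms \<sigma>_in(2) norm_fst_\<sigma> norm_snd_\<sigma> unfolding symA_def by metis
qed

text \<open>
  The function \<open>norm (fst x) * norm (snd x)\<close> in \<open>\<tau>\<close> is not differentiable where one factor
  vanishes.  By symmetry, \<open>\<tau> x\<close> may be replaced by
  \<open>height x *\<^sub>R p + norm (fst x) *\<^sub>R J (snd x)\<close>, which is smooth away from \<open>fst x = 0\<close>, or by
  the same expression with the components exchanged, which is smooth away from \<open>snd x = 0\<close>.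
  In an annulus the two components are not both small, so these two charts cover it with a gap.
\<close>

lemma full_hoelder_pullback_\<tau>:
  assumes v: "full_hoelder k \<alpha> D v" "symD v"
  shows "full_hoelder k \<alpha> A (\<lambda>x. v (\<tau> x))"
proof -
  (* outside A2, and so wherever only the first chart is available, the first component exceeds 3 a / 4 *)
  define A1 where "A1 = {x\<in>A. a / 4 < norm (fst x)}"
  define A2 where "A2 = {x\<in>A. a / 4 < norm (snd x)}"
  have op: "open A1" "open A2"
    unfolding A1_def A2_def annulus_def
    by (simp_all only: mem_Collect_eq) (intro open_Collect_conj open_Collect_less continuous_intros)+
  have bd: "bounded A1" "bounded A2"
    unfolding A1_def A2_def using bounded_subset[OF bounded_annulus[of a b, where 'a = "'b \<times> 'b"]] by auto
  have lin: "bounded_linear (fst :: 'b \<times> 'b \<Rightarrow> 'b)" "bounded_linear (snd :: 'b \<times> 'b \<Rightarrow> 'b)"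
    "bounded_linear J"
    using bounded_linear_fst bounded_linear_snd J(1) linear_conv_bounded_linear by auto
  have height: "full_hoelder k 1 T height" if "bounded T" for T
  proof -
    have "full_hoelder k 1 T (\<lambda>x. (fst x \<bullet> fst x) * (1/2) + (snd x \<bullet> snd x) * (- (1/2)))"
      by (intro full_hoelder_add full_hoelder_mult full_hoelder_const full_hoelder_inner_self lin that) auto
    moreover have "(\<lambda>x. (fst x \<bullet> fst x) * (1/2) + (snd x \<bullet> snd x) * (- (1/2))) = height"
      by (auto simp: height_def field_simps)
    ultimately show ?thesis by simp
  qed
  have chart: "full_hoelder k \<alpha> T (\<lambda>x. v (\<tau> x))"
    if T: "open T" "bounded T" "T \<subseteq> A" and L: "bounded_linear L" "bounded_linear M"
      and LM: "\<And>x. norm (L x) * norm (M x) = norm (fst x) * norm (snd x)" "\<And>x. x \<in> T \<Longrightarrow> a / 4 < norm (L x)"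
    for T :: "('b \<times> 'b) set" and L M :: "'b \<times> 'b \<Rightarrow> 'b"
  proof (rule full_hoelder_cong[OF T(1)])
    define \<phi> where "\<phi> = (\<lambda>x. height x *\<^sub>R p + norm (L x) *\<^sub>R J (M x))"
    have w: "(norm (L x) *\<^sub>R J (M x)) \<bullet> p = 0" "norm (norm (L x) *\<^sub>R J (M x)) = norm (fst x) * norm (snd x)" for x
      using J LM(1) by auto
    show "v (\<phi> x) = v (\<tau> x)" if "x \<in> T" for x
      using symD_eq[OF v(2) _ w] that T(3) closure_subset unfolding \<phi>_def by (metis subsetD)
    show "full_hoelder k \<alpha> T (\<lambda>x. v (\<phi> x))"
    proof (rule full_hoelder_compose[where \<phi> = \<phi> and u = v, OF T(2) \<alpha> _ v(1)])
      show "\<phi> ` T \<subseteq> D"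
        using annulus_iff(1)[OF norm_height_point(1)[OF w]] T(3) unfolding \<phi>_def by blast
      show "full_hoelder k 1 T (\<lambda>x. \<phi> x \<bullet> j)" for j
        unfolding \<phi>_def inner_add_left inner_scaleR_left using a
        by (intro full_hoelder_add full_hoelder_mult full_hoelder_const height full_hoelder_norm[OF L(1) T(2), of "a / 4"]
            LM(2) full_hoelder_bounded_linear T(2)
            bounded_linear_compose[OF bounded_linear_inner_left bounded_linear_compose[OF lin(3) L(2)]]) auto
    qed
  qed
  have "full_hoelder k \<alpha> (A1 \<union> A2) (\<lambda>x. v (\<tau> x))"
  proof (rule full_hoelder_Un[OF op bd])
    show "full_hoelder k \<alpha> A1 (\<lambda>x. v (\<tau> x))"
      by (rule chart[OF op(1) bd(1) _ lin(1,2)]) (auto simp: A1_def)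
    show "full_hoelder k \<alpha> A2 (\<lambda>x. v (\<tau> x))"
      by (rule chart[OF op(2) bd(2) _ lin(2,1)]) (auto simp: A2_def)
    show "0 < a / 2" "0 \<le> \<alpha>" using a \<alpha> by auto
    fix x y assume "x \<in> A1 - A2" "y \<in> A2 - A1"
    then have x: "a < norm x" "norm (snd x) \<le> a / 4" and y: "norm (fst y) \<le> a / 4"
      by (auto simp: A1_def A2_def annulus_def)
    have "norm x \<le> norm (fst x) + norm (snd x)" by (metis norm_Pair_le prod.collapse)
    moreover have "norm (fst x) - norm (fst y) \<le> norm (fst (x - y))" by (simp add: norm_triangle_ineq2)
    moreover have "norm (fst (x - y)) \<le> norm (x - y)" by (metis norm_fst_le prod.collapse)
    ultimately show "a / 2 \<le> dist x y" using x y unfolding dist_norm by linarith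
  qed
  moreover have "A1 \<union> A2 = A"
  proof -
    have "a / 4 < norm (fst x) \<or> a / 4 < norm (snd x)" if "x \<in> A" for x
    proof -
      have "norm x \<le> norm (fst x) + norm (snd x)" by (metis norm_Pair_le prod.collapse)
      then show ?thesis using that a by (auto simp: annulus_def)
    qed
    then show ?thesis by (auto simp: A1_def A2_def)
  qed
  ultimately show ?thesis by simp
qed

text \<open>
  Here \<open>\<sigma> z\<close> may be replaced by a point whose first component is
  \<open>sqrt (norm z + z \<bullet> p) *\<^sub>R e\<close> and whose second component is the multiple
  \<open>K z /\<^sub>R sqrt (norm z + z \<bullet> p)\<close> of the projection of z.  This is smooth away from the
  negative axis, because \<open>norm (K z)\<close> is the product of the two square roots in \<open>\<sigma> z\<close>.  The
  chart with the other square root is smooth away from the positive axis.  In the proof,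
  \<open>s = 1\<close> and \<open>s = - 1\<close> select the chart.
\<close>

lemma full_hoelder_pullback_\<sigma>:
  assumes u: "full_hoelder k \<alpha> A u" "symA u"
  shows "full_hoelder k \<alpha> D (\<lambda>z. u (\<sigma> z))"
proof -
  define g where "g = (\<lambda>s z. norm z + s * (z \<bullet> p))"
  define T where "T = (\<lambda>s. {z\<in>D. norm z / 2 < g s z})"
  have op: "open (T s)" for s
    unfolding T_def g_def annulus_def
    by (simp only: mem_Collect_eq) (intro open_Collect_conj open_Collect_less continuous_intros ballI; simp)
  have TD: "T s \<subseteq> D" for s by (auto simp: T_def)
  have bd: "bounded (T s)" for s
    using bounded_subset[OF bounded_annulus TD] .
  have gT: "a\<^sup>2 / 4 < g s z" if "z \<in> T s" for s z using that by (auto simp: T_def annulus_def)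
  have g: "full_hoelder k 1 (T s) (g s)" for s
    unfolding g_def
    by (intro full_hoelder_add full_hoelder_mult full_hoelder_const full_hoelder_bounded_linear
        bounded_linear_inner_left bd full_hoelder_norm[where L = "\<lambda>z. z" and c = "a\<^sup>2 / 2"] bounded_linear_ident radii)
      (auto simp: T_def annulus_def)
  have gr: "full_hoelder k 1 (T s) (\<lambda>z. g s z powr r)" for s r
    using a gT by (intro full_hoelder_powr_compose[OF bd g, of "a\<^sup>2 / 4"]) auto
  have Kn: "g s z powr (- (1 / 2)) * norm (K z) = sqrt (g (- s) z)" if "z \<in> T s" "s\<^sup>2 = 1" for s z
  proof -
    have pos: "0 < g s z" using gT[OF that(1)] zero_le_power2[of a] by linarith
    have "norm (K z) = sqrt (g s z * g (- s) z)"
    proof -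
      have "g s z * g (- s) z = (norm z)\<^sup>2 - s\<^sup>2 * (z \<bullet> p)\<^sup>2"
        by (simp add: g_def power2_eq_square algebra_simps)
      then show ?thesis using K(2)[of z] that(2) by (metis mult_1 norm_ge_zero real_sqrt_unique)
    qed
    then show ?thesis using pos by (simp add: powr_minus powr_half_sqrt real_sqrt_mult field_simps)
  qed
  have comp1: "full_hoelder k 1 (T s) (\<lambda>z. (g s z powr (1 / 2) *\<^sub>R e) \<bullet> j)" for s j
    unfolding inner_scaleR_left by (intro full_hoelder_mult gr full_hoelder_const bd) auto
  have comp2: "full_hoelder k 1 (T s) (\<lambda>z. (g s z powr (- (1 / 2)) *\<^sub>R K z) \<bullet> j)" for s j
    unfolding inner_scaleR_left using K(1)
    by (intro full_hoelder_mult gr full_hoelder_bounded_linear bd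
        bounded_linear_compose[OF bounded_linear_inner_left]) (auto simp: linear_conv_bounded_linear)
  have chart: "full_hoelder k \<alpha> (T s) (\<lambda>z. u (\<sigma> z))"
    if eq: "\<And>z. z \<in> T s \<Longrightarrow> norm (fst (\<phi> z)) = sqrt (norm z + z \<bullet> p)"
        "\<And>z. z \<in> T s \<Longrightarrow> norm (snd (\<phi> z)) = sqrt (norm z - z \<bullet> p)"
      and comp: "\<And>j. full_hoelder k 1 (T s) (\<lambda>z. fst (\<phi> z) \<bullet> j)" "\<And>j. full_hoelder k 1 (T s) (\<lambda>z. snd (\<phi> z) \<bullet> j)"
    for s and \<phi> :: "'c \<Rightarrow> 'b \<times> 'b"
  proof (rule full_hoelder_cong[OF op])
    show "u (\<phi> z) = u (\<sigma> z)" if "z \<in> T s" for z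
      using symA_eq[OF u(2) _ eq[OF that]] that TD closure_subset by (metis subsetD)
    show "full_hoelder k \<alpha> (T s) (\<lambda>z. u (\<phi> z))"
    proof (rule full_hoelder_compose[where \<phi> = \<phi> and u = u, OF bd \<alpha> _ u(1)])
      show "\<phi> ` T s \<subseteq> A"
      proof (rule image_subsetI)
        fix z assume z: "z \<in> T s"
        show "\<phi> z \<in> A"
          using annulus_iff(1)[of z "\<phi> z"] norm_and_height_from_radii(1)[OF eq[OF z]] z TD by auto
      qed
      show "full_hoelder k 1 (T s) (\<lambda>z. \<phi> z \<bullet> j)" for j
        unfolding inner_prod_def by (intro full_hoelder_add comp)
    qed
  qed
  have "full_hoelder k \<alpha> (T 1 \<union> T (- 1)) (\<lambda>z. u (\<sigma> z))"
  proof (rule full_hoelder_Un[OF op op bd bd])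
    have sq: "norm (g s z powr (1 / 2) *\<^sub>R e) = sqrt (g s z)" if "z \<in> T s" for s z
    proof -
      have "0 \<le> g s z" using gT[OF that] zero_le_power2[of a] by linarith
      then show ?thesis using e by (simp add: powr_half_sqrt)
    qed
    have g1: "g 1 z = norm z + z \<bullet> p" "g (- 1) z = norm z - z \<bullet> p" for z by (auto simp: g_def)
    show "full_hoelder k \<alpha> (T 1) (\<lambda>z. u (\<sigma> z))"
    proof (rule chart[where \<phi> = "\<lambda>z. (g 1 z powr (1 / 2) *\<^sub>R e, g 1 z powr (- (1 / 2)) *\<^sub>R K z)"])
      fix z assume "z \<in> T 1"
      then show "norm (fst (g 1 z powr (1 / 2) *\<^sub>R e, g 1 z powr (- (1 / 2)) *\<^sub>R K z)) = sqrt (norm z + z \<bullet> p)"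
        "norm (snd (g 1 z powr (1 / 2) *\<^sub>R e, g 1 z powr (- (1 / 2)) *\<^sub>R K z)) = sqrt (norm z - z \<bullet> p)"
        using Kn[of z 1] sq[of z 1] g1 by simp_all
    qed (simp_all only: fst_conv snd_conv comp1 comp2)
    show "full_hoelder k \<alpha> (T (- 1)) (\<lambda>z. u (\<sigma> z))"
    proof (rule chart[where \<phi> = "\<lambda>z. (g (- 1) z powr (- (1 / 2)) *\<^sub>R K z, g (- 1) z powr (1 / 2) *\<^sub>R e)"])
      fix z assume "z \<in> T (- 1)"
      then show "norm (fst (g (- 1) z powr (- (1 / 2)) *\<^sub>R K z, g (- 1) z powr (1 / 2) *\<^sub>R e)) = sqrt (norm z + z \<bullet> p)"
        "norm (snd (g (- 1) z powr (- (1 / 2)) *\<^sub>R K z, g (- 1) z powr (1 / 2) *\<^sub>R e)) = sqrt (norm z - z \<bullet> p)"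
        using Kn[of z "- 1"] sq[of z "- 1"] g1 by simp_all
    qed (simp_all only: fst_conv snd_conv comp1 comp2)
    show "0 < a\<^sup>2 / 2" "0 \<le> \<alpha>" using radii \<alpha> by auto
    fix z y assume "z \<in> T 1 - T (- 1)" "y \<in> T (- 1) - T 1"
    then have "a\<^sup>2 / 2 < norm z" "a\<^sup>2 / 2 < norm y" "norm z / 2 \<le> z \<bullet> p" "y \<bullet> p \<le> - (norm y / 2)"
      by (auto simp: T_def g_def annulus_def)
    moreover have "(z - y) \<bullet> p \<le> norm (z - y)" using abs_inner_p_le[of "z - y"] by linarith
    ultimately show "a\<^sup>2 / 2 \<le> dist z y" unfolding dist_norm inner_diff_left by linarith
  qed
  moreover have "T 1 \<union> T (- 1) = D"
  proof -
    have "norm z / 2 < norm z + z \<bullet> p \<or> norm z / 2 < norm z - z \<bullet> p" if "z \<in> D" for z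
    proof -
      have "0 < norm z" using that radii by (auto simp: annulus_def)
      then show ?thesis by linarith
    qed
    then show ?thesis by (auto simp: T_def g_def)
  qed
  ultimately show ?thesis by simp
qed


section \<open>The Laplacian of the pullback\<close>

text \<open>
  Away from the axes both functions are expressed through one C^2 function V of the height and of
  the squared distance \<open>\<kappa>\<close> from the axis p.  The square makes the two
  inner functions polynomial, with orthogonal gradients in both cases, and the chain rule
  gives \<open>V11 + 4 \<kappa> V22 + 2 m V2\<close> for the Laplacian of v, where \<open>m = DIM('b)\<close>, and the same
  expression times \<open>(norm x)\<^sup>2\<close> for the Laplacian of the pullback.
\<close>

lemma laplacian_pullback_off_axis:
  assumes v: "full_hoelder 2 \<alpha> D v" "symD v"
    and x: "x \<in> A" "fst x \<noteq> 0" "snd x \<noteq> 0"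
    and z: "norm z = (norm x)\<^sup>2 / 2" "z \<bullet> p = height x"
  shows "laplacian (\<lambda>x. v (\<tau> x)) x = 2 * norm z * laplacian v z"
proof -
  define \<kappa> where "\<kappa> = (\<lambda>x :: 'b \<times> 'b. (fst x \<bullet> fst x) * (snd x \<bullet> snd x))"
  define \<kappa>' where "\<kappa>' = (\<lambda>z. z \<bullet> z - (z \<bullet> p)\<^sup>2)"
  define \<psi> where "\<psi> = (\<lambda>w. fst w *\<^sub>R p + sqrt (snd w) *\<^sub>R q)"
  define V where "V = (\<lambda>w. v (\<psi> w))"
  have \<kappa>0: "0 < \<kappa> x" using x by (simp add: \<kappa>_def)
  have \<kappa>z: "\<kappa>' z = \<kappa> x"
    unfolding \<kappa>'_def z(2) dot_square_norm z(1) norm_sq_components \<kappa>_def height_def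
    by (simp add: power2_eq_square field_simps)
  have \<psi>\<tau>: "\<psi> (height y, \<kappa> y) = \<tau> y" for y
    by (simp add: \<psi>_def \<tau>_def \<kappa>_def real_sqrt_mult norm_eq_sqrt_inner)
  (* a neighbourhood on which the square root in \<psi> is smooth and \<psi> stays in D *)
  define O' where "O' = {w. \<kappa> x / 2 < snd w} \<inter> \<psi> -` D"
  have "open O'"
    unfolding O'_def \<psi>_def
    by (intro open_Int open_Collect_less open_vimage open_annulus continuous_intros)
  moreover have w0: "(height x, \<kappa> x) \<in> O'"
    using \<kappa>0 \<psi>\<tau>[of x] \<tau>_in(1) x(1) by (simp add: O'_def)
  ultimately obtain \<epsilon> where \<epsilon>: "0 < \<epsilon>" "ball (height x, \<kappa> x) \<epsilon> \<subseteq> O'"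
    using open_contains_ball by metis
  define W where "W = ball (height x, \<kappa> x) \<epsilon>"
  have W: "open W" "bounded W" "(height x, \<kappa> x) \<in> W" using \<epsilon>(1) by (auto simp: W_def)
  have WO: "\<kappa> x / 2 < snd w" "\<psi> w \<in> D" if "w \<in> W" for w
    using \<epsilon>(2) that by (auto simp: W_def O'_def)
  have "full_hoelder 2 \<alpha> W V"
    unfolding V_def
  proof (rule full_hoelder_compose[where \<phi> = \<psi> and u = v, OF W(2) \<alpha> _ v(1)])
    show "\<psi> ` W \<subseteq> D" using WO(2) by blast
    fix j :: 'c
    have "full_hoelder 2 1 W (\<lambda>w. fst w * (p \<bullet> j) + snd w powr (1 / 2) * (q \<bullet> j))"
      using \<kappa>0 WO(1) by (intro full_hoelder_add full_hoelder_mult W(2) full_hoelder_const full_hoelder_bounded_linear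
          bounded_linear_fst bounded_linear_snd full_hoelder_powr_compose[of W 2 snd "\<kappa> x / 2"]) auto
    then show "full_hoelder 2 1 W (\<lambda>w. \<psi> w \<bullet> j)"
    proof (rule full_hoelder_cong[OF W(1), rotated])
      fix w assume "w \<in> W"
      then have "0 \<le> snd w" using WO(1) \<kappa>0 by fastforce
      then show "fst w * (p \<bullet> j) + snd w powr (1 / 2) * (q \<bullet> j) = \<psi> w \<bullet> j"
        by (simp add: \<psi>_def inner_add_left powr_half_sqrt)
    qed
  qed
  from full_hoelder_2_partials[OF this W(3)] obtain V1 V2 V11 V12 V21 V22 where V:
    "\<And>w. w \<in> W \<Longrightarrow> (V has_derivative (\<lambda>h. V1 w * fst h + V2 w * snd h)) (at w)"
    "(V1 has_derivative (\<lambda>h. V11 * fst h + V12 * snd h)) (at (height x, \<kappa> x))"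
    "(V2 has_derivative (\<lambda>h. V21 * fst h + V22 * snd h)) (at (height x, \<kappa> x))"
    by blast
  let ?L = "V11 + 4 * \<kappa> x * V22 + 2 * real DIM('b) * V2 (height x, \<kappa> x)"
  have "laplacian v z = ?L"
  proof -
    define U where "U = D \<inter> (\<lambda>z. (z \<bullet> p, \<kappa>' z)) -` W"
    have U: "open U" unfolding U_def \<kappa>'_def
      by (intro open_Int open_annulus open_vimage W(1) continuous_intros)
    have zU: "z \<in> U" unfolding U_def using W(3) annulus_iff(1)[OF z(1)] x(1) \<kappa>z z(2) by simp
    have "laplacian v z = laplacian (\<lambda>z. V (z \<bullet> p, \<kappa>' z)) z"
    proof (rule laplacian_cong[OF U zU])
      fix y assume "y \<in> U"
      then have y: "y \<in> D" "(y \<bullet> p, \<kappa>' y) \<in> W" by (auto simp: U_def)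
      have k: "0 \<le> \<kappa>' y" using WO(1)[OF y(2)] \<kappa>0 by simp
      have "(norm (\<psi> (y \<bullet> p, \<kappa>' y)))\<^sup>2 = (norm y)\<^sup>2"
        unfolding power2_norm_eq_inner \<psi>_def using k pp qq q(2)
        by (simp add: inner_add_left inner_add_right inner_commute[of p q]) (simp add: \<kappa>'_def power2_eq_square)
      then have "norm (\<psi> (y \<bullet> p, \<kappa>' y)) = norm y" by (simp add: power2_eq_iff_nonneg)
      moreover have "\<psi> (y \<bullet> p, \<kappa>' y) \<bullet> p = y \<bullet> p" using pp q(2) by (simp add: \<psi>_def inner_add_left)
      moreover have "y \<in> closure D" "\<psi> (y \<bullet> p, \<kappa>' y) \<in> closure D"
        using y(1) WO(2)[OF y(2)] closure_subset by blast+
      ultimately show "v y = V (y \<bullet> p, \<kappa>' y)" using v(2) unfolding symD_def V_def by metis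
    qed
    also have "\<dots> = V11 * (p \<bullet> p) + (V12 + V21) * (p \<bullet> (2 *\<^sub>R (z - (z \<bullet> p) *\<^sub>R p)))
        + V22 * ((2 *\<^sub>R (z - (z \<bullet> p) *\<^sub>R p)) \<bullet> (2 *\<^sub>R (z - (z \<bullet> p) *\<^sub>R p)))
        + V1 (z \<bullet> p, \<kappa>' z) * (\<Sum>i\<in>Basis. (0 :: 'c) \<bullet> i)
        + V2 (z \<bullet> p, \<kappa>' z) * (\<Sum>i\<in>Basis. (2 *\<^sub>R (i - (i \<bullet> p) *\<^sub>R p)) \<bullet> i)"
    proof (rule laplacian_function_of_two[where U = U and W = W and A = "\<lambda>z. z \<bullet> p" and B = \<kappa>'
          and a = "\<lambda>_. p" and a' = "\<lambda>_. 0" and b = "\<lambda>z. 2 *\<^sub>R (z - (z \<bullet> p) *\<^sub>R p)"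
          and b' = "\<lambda>h. 2 *\<^sub>R (h - (h \<bullet> p) *\<^sub>R p)"])
      show "(V has_derivative (\<lambda>h. V1 w * fst h + V2 w * snd h)) (at w)" if "w \<in> W" for w by (rule V(1)[OF that])
      show "(V1 has_derivative (\<lambda>h. V11 * fst h + V12 * snd h)) (at (z \<bullet> p, \<kappa>' z))"
        "(V2 has_derivative (\<lambda>h. V21 * fst h + V22 * snd h)) (at (z \<bullet> p, \<kappa>' z))"
        using V(2,3) by (simp_all add: \<kappa>z z(2))
      show "(\<kappa>' has_derivative (\<bullet>) (2 *\<^sub>R (y - (y \<bullet> p) *\<^sub>R p))) (at y)" for y
        unfolding \<kappa>'_def
        by (auto intro!: derivative_eq_intros simp: inner_diff_left inner_commute algebra_simps)
      show "((\<lambda>y. 2 *\<^sub>R (y - (y \<bullet> p) *\<^sub>R p)) has_derivative (\<lambda>h. 2 *\<^sub>R (h - (h \<bullet> p) *\<^sub>R p))) (at z)"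
        by (auto intro!: derivative_eq_intros)
      show "((\<lambda>y. y \<bullet> p) has_derivative (\<bullet>) p) (at y)" for y
        by (auto intro!: derivative_eq_intros simp: inner_commute)
    qed (use U zU in \<open>auto simp: U_def\<close>)
    also have "(\<Sum>i\<in>Basis. (2 *\<^sub>R (i - (i \<bullet> p) *\<^sub>R p)) \<bullet> i) = 2 * real DIM('b)"
    proof -
      have "(\<Sum>i\<in>Basis. (2 *\<^sub>R (i - (i \<bullet> p) *\<^sub>R p)) \<bullet> i) = (\<Sum>i\<in>Basis. 2 - 2 * ((p \<bullet> i) * (p \<bullet> i)))"
        by (intro sum.cong) (auto simp: inner_diff_left inner_commute algebra_simps)
      also have "\<dots> = 2 * real DIM('c) - 2 * (p \<bullet> p)"
        by (simp add: sum_subtractf sum_distrib_left[symmetric] flip: euclidean_inner)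
      finally show ?thesis using dim pp by simp
    qed
    also have "(2 *\<^sub>R (z - (z \<bullet> p) *\<^sub>R p)) \<bullet> (2 *\<^sub>R (z - (z \<bullet> p) *\<^sub>R p)) = 4 * \<kappa>' z"
      using pp by (simp add: \<kappa>'_def inner_diff_left inner_diff_right inner_commute power2_eq_square algebra_simps)
    also have "p \<bullet> (2 *\<^sub>R (z - (z \<bullet> p) *\<^sub>R p)) = 0"
      using pp by (simp add: inner_diff_right inner_commute)
    finally show ?thesis using pp by (simp add: \<kappa>z z(2))
  qed
  moreover have "laplacian (\<lambda>x. v (\<tau> x)) x = (norm x)\<^sup>2 * ?L"
  proof -
    define U where "U = A \<inter> (\<lambda>y. (height y, \<kappa> y)) -` W"
    have U: "open U" unfolding U_def \<kappa>_def height_def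
      by (intro open_Int open_annulus open_vimage W(1) continuous_intros) auto
    have xU: "x \<in> U" unfolding U_def using W(3) x(1) by simp
    let ?a = "\<lambda>y :: 'b \<times> 'b. (fst y, - snd y)"
    let ?b = "\<lambda>y :: 'b \<times> 'b. ((2 * (snd y \<bullet> snd y)) *\<^sub>R fst y, (2 * (fst y \<bullet> fst y)) *\<^sub>R snd y)"
    let ?b' = "\<lambda>h :: 'b \<times> 'b. ((4 * (snd x \<bullet> snd h)) *\<^sub>R fst x + (2 * (snd x \<bullet> snd x)) *\<^sub>R fst h,
        (4 * (fst x \<bullet> fst h)) *\<^sub>R snd x + (2 * (fst x \<bullet> fst x)) *\<^sub>R snd h)"
    have "laplacian (\<lambda>x. v (\<tau> x)) x = laplacian (\<lambda>y. V (height y, \<kappa> y)) x"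
      by (rule laplacian_cong[OF U xU]) (simp add: V_def \<psi>\<tau>)
    also have "\<dots> = V11 * (?a x \<bullet> ?a x) + (V12 + V21) * (?a x \<bullet> ?b x) + V22 * (?b x \<bullet> ?b x)
        + V1 (height x, \<kappa> x) * (\<Sum>i\<in>Basis. ?a i \<bullet> i) + V2 (height x, \<kappa> x) * (\<Sum>i\<in>Basis. ?b' i \<bullet> i)"
    proof (rule laplacian_function_of_two[where U = U and W = W and A = height and B = \<kappa>
          and a = ?a and a' = ?a and b = ?b and b' = ?b'])
      show "(V has_derivative (\<lambda>h. V1 w * fst h + V2 w * snd h)) (at w)" if "w \<in> W" for w by (rule V(1)[OF that])
      show "(V1 has_derivative (\<lambda>h. V11 * fst h + V12 * snd h)) (at (height x, \<kappa> x))"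
        "(V2 has_derivative (\<lambda>h. V21 * fst h + V22 * snd h)) (at (height x, \<kappa> x))"
        using V(2,3) .
      show "(height has_derivative (\<bullet>) (?a y)) (at y)" for y
        unfolding height_def
        by (auto intro!: derivative_eq_intros ext simp: inner_prod_def inner_commute)
      show "(\<kappa> has_derivative (\<bullet>) (?b y)) (at y)" for y
        unfolding \<kappa>_def
        by (auto intro!: derivative_eq_intros ext simp: inner_prod_def inner_commute algebra_simps)
      show "(?a has_derivative ?a) (at x)" by (auto intro!: derivative_eq_intros)
      show "(?b has_derivative ?b') (at x)"
        by (auto intro!: derivative_eq_intros ext simp: inner_commute algebra_simps)
    qed (use U xU in \<open>auto simp: U_def\<close>)
    also have "(\<Sum>i\<in>Basis. ?a i \<bullet> i) = 0"
      by (subst sum_Basis_prod) (simp add: inner_prod_def sum_negf)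
    also have "(\<Sum>i\<in>Basis. ?b' i \<bullet> i) = 2 * real DIM('b) * (norm x)\<^sup>2"
      unfolding norm_sq_components power2_norm_eq_inner
      by (subst sum_Basis_prod) (simp add: inner_prod_def algebra_simps)
    also have "?a x \<bullet> ?a x = (norm x)\<^sup>2"
      unfolding norm_sq_components power2_norm_eq_inner by (simp add: inner_prod_def)
    also have "?a x \<bullet> ?b x = 0" by (simp add: inner_prod_def)
    also have "?b x \<bullet> ?b x = 4 * \<kappa> x * (norm x)\<^sup>2"
      unfolding norm_sq_components power2_norm_eq_inner by (simp add: inner_prod_def \<kappa>_def algebra_simps)
    finally show ?thesis by (simp add: algebra_simps)
  qed
  ultimately show ?thesis by (simp add: z(1))
qed

text \<open>
  Both sides are continuous, and the points with two nonzero components are dense.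
\<close>

lemma laplacian_pullback_\<tau>:
  assumes v: "full_hoelder 2 \<alpha> D v" "symD v" and x: "x \<in> A"
  shows "laplacian (\<lambda>x. v (\<tau> x)) x = 2 * norm (\<tau> x) * laplacian v (\<tau> x)"
proof -
  have "laplacian (\<lambda>x. v (\<tau> x)) x - 2 * norm (\<tau> x) * laplacian v (\<tau> x) = 0"
  proof (rule continuous_zero_from_dense[OF open_annulus _ x])
    have "\<tau> ` A \<subseteq> D" using \<tau>_in(1) by blast
    then show "continuous_on A (\<lambda>x. laplacian (\<lambda>x. v (\<tau> x)) x - 2 * norm (\<tau> x) * laplacian v (\<tau> x))"
      using continuous_on_laplacian[OF open_annulus \<alpha>(1) full_hoelder_pullback_\<tau>[OF v]]
        continuous_on_compose2[OF continuous_on_laplacian[OF open_annulus \<alpha>(1) v(1)] continuous_on_\<tau>[of A]]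
      by (intro continuous_intros continuous_on_\<tau>) auto
    fix U assume U: "open U" "U \<noteq> {}" "U \<subseteq> A"
    then obtain y where "y \<in> U" "fst y \<noteq> 0" "snd y \<noteq> 0" using nonzero_components_dense by blast
    moreover from this have "laplacian (\<lambda>x. v (\<tau> x)) y = 2 * norm (\<tau> y) * laplacian v (\<tau> y)"
      using laplacian_pullback_off_axis[OF v _ _ _ norm_\<tau> \<tau>_inner_p] U(3) by blast
    ultimately show "\<exists>y\<in>U. laplacian (\<lambda>x. v (\<tau> x)) y - 2 * norm (\<tau> y) * laplacian v (\<tau> y) = 0"
      by (metis diff_self)
  qed
  then show ?thesis by simp
qed

text \<open>
  The map \<open>\<tau>\<close> only reaches the half plane spanned by p and q, so the equation in all of D has to
  be tested at \<open>\<sigma> z\<close>.  Here the points off the axis p are dense.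
\<close>

lemma laplacian_pullback_\<sigma>:
  assumes v: "full_hoelder 2 \<alpha> D v" "symD v" and z: "z \<in> D"
  shows "laplacian (\<lambda>x. v (\<tau> x)) (\<sigma> z) = 2 * norm z * laplacian v z"
proof -
  have "laplacian (\<lambda>x. v (\<tau> x)) (\<sigma> z) - 2 * norm z * laplacian v z = 0"
  proof (rule continuous_zero_from_dense[OF open_annulus _ z])
    have "\<sigma> ` D \<subseteq> A" using \<sigma>_in(1) by blast
    then show "continuous_on D (\<lambda>z. laplacian (\<lambda>x. v (\<tau> x)) (\<sigma> z) - 2 * norm z * laplacian v z)"
      using continuous_on_laplacian[OF open_annulus \<alpha>(1) v(1)]
        continuous_on_compose2[OF continuous_on_laplacian[OF open_annulus \<alpha>(1) full_hoelder_pullback_\<tau>[OF v]]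
          continuous_on_\<sigma>[of D]]
      by (intro continuous_intros) auto
    fix U assume U: "open U" "U \<noteq> {}" "U \<subseteq> D"
    have "\<exists>y\<in>U. K y \<noteq> 0"
    proof (rule ccontr)
      assume "\<not> ?thesis"
      moreover obtain y \<epsilon> where y: "y \<in> U" "0 < \<epsilon>" "cball y \<epsilon> \<subseteq> U" using U open_contains_cball by (metis ex_in_conv)
      moreover have "y + \<epsilon> *\<^sub>R q \<in> cball y \<epsilon>" using y(2) q(1) by (simp add: dist_norm)
      ultimately have "K y = 0" "K (y + \<epsilon> *\<^sub>R q) = 0" by blast+
      then have "K q = 0" using y(2) by (simp add: linear_add[OF K(1)] linear_cmul[OF K(1)])
      then show False using K(2)[of q] q by simp
    qed
    then obtain y where y: "y \<in> U" "K y \<noteq> 0" by blast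
    then have "(y \<bullet> p)\<^sup>2 < (norm y)\<^sup>2" using K(2)[of y] zero_less_power2[of "norm (K y)"] by auto
    then have "\<bar>y \<bullet> p\<bar> < norm y" using power2_less_imp_less[of "\<bar>y \<bullet> p\<bar>" "norm y"] by simp
    then have "fst (\<sigma> y) \<noteq> 0" "snd (\<sigma> y) \<noteq> 0" using e by (auto simp: \<sigma>_def)
    then have "laplacian (\<lambda>x. v (\<tau> x)) (\<sigma> y) = 2 * norm y * laplacian v y"
      using y(1) U(3) \<sigma>_in(1) norm_\<sigma>[of y] norm_and_height_from_radii(2)[OF norm_fst_\<sigma> norm_snd_\<sigma>, of y]
      by (intro laplacian_pullback_off_axis v) auto
    with y(1) show "\<exists>y\<in>U. laplacian (\<lambda>x. v (\<tau> x)) (\<sigma> y) - 2 * norm y * laplacian v y = 0" by auto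
  qed
  then show ?thesis by simp
qed

section \<open>The bijection\<close>

lemma symD_pullback_\<sigma>: "symA u \<Longrightarrow> symD (\<lambda>z. u (\<sigma> z))"
  unfolding symA_def symD_def by (metis \<sigma>_in(2) norm_fst_\<sigma> norm_snd_\<sigma>)

lemma symA_pullback_\<tau>: "symD v \<Longrightarrow> symA (\<lambda>x. v (\<tau> x))"
  unfolding symA_def symD_def
  by (auto simp: \<tau>_in(2) norm_\<tau> \<tau>_inner_p norm_sq_components height_def dot_square_norm)

lemma solves_PA_iff_solves_PD:
  assumes v: "full_hoelder 2 \<alpha> D v" "symD v"
    and u: "\<And>x. x \<in> closure A \<Longrightarrow> u x = v (\<tau> x)"
  shows "solves_PA bc f a b u \<longleftrightarrow> solves_PD bc f a b v"
proof -
  have lapu: "laplacian u x = laplacian (\<lambda>x. v (\<tau> x)) x" if "x \<in> A" for x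
    using u closure_subset by (intro laplacian_cong[OF open_annulus that]) blast
  have v\<sigma>: "v z = u (\<sigma> z)" if "z \<in> closure D" for z
  proof -
    have "v z = v (\<tau> (\<sigma> z))" using v(2) that \<tau>_\<sigma>[of z] \<tau>_in(2) \<sigma>_in(2) unfolding symD_def by metis
    then show ?thesis using u \<sigma>_in(2) that by simp
  qed
  have "(\<forall>x\<in>A. - laplacian u x = f (u x)) \<longleftrightarrow> (\<forall>z\<in>D. - laplacian v z = f (v z) / (2 * norm z))"
  proof safe
    fix z assume PA: "\<forall>x\<in>A. - laplacian u x = f (u x)" and z: "z \<in> D"
    have "z \<in> closure D" "0 < norm z"
      using z radii closure_subset by (blast, auto simp: annulus_def)
    moreover from this(1) have "- (2 * norm z * laplacian v z) = f (v z)"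
      using PA[rule_format, of "\<sigma> z"] \<sigma>_in(1) z lapu laplacian_pullback_\<sigma>[OF v z] v\<sigma>[of z] by auto
    ultimately show "- laplacian v z = f (v z) / (2 * norm z)" by (simp add: field_simps)
  next
    fix x assume PD: "\<forall>z\<in>D. - laplacian v z = f (v z) / (2 * norm z)" and x: "x \<in> A"
    have "0 < norm (\<tau> x)" using \<tau>_in(1)[of x] x radii by (auto simp: annulus_def)
    moreover have "- laplacian v (\<tau> x) = f (u x) / (2 * norm (\<tau> x))"
      using PD[rule_format, of "\<tau> x"] \<tau>_in(1)[of x] x u[of x] closure_subset[of A] by auto
    ultimately show "- laplacian u x = f (u x)"
      unfolding lapu[OF x] laplacian_pullback_\<tau>[OF v x] by (simp add: field_simps)
  qed
  moreover have "boundary_condition bc a b u \<longleftrightarrow> boundary_condition bc (a\<^sup>2 / 2) (b\<^sup>2 / 2) v"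
  proof
    assume "boundary_condition bc a b u"
    then show "boundary_condition bc (a\<^sup>2 / 2) (b\<^sup>2 / 2) v"
    proof (rule boundary_condition_pullback[OF radii a ab _ \<sigma>_scaleR, rotated -1])
      show "norm (\<sigma> z) = a" if "norm z = a\<^sup>2 / 2" for z
        using norm_\<sigma>[of z] that a by (simp add: power2_eq_iff_nonneg)
      show "norm (\<sigma> z) = b" if "norm z = b\<^sup>2 / 2" for z
        using norm_\<sigma>[of z] that a ab by (simp add: power2_eq_iff_nonneg)
    qed (use v\<sigma> in auto)
  next
    assume "boundary_condition bc (a\<^sup>2 / 2) (b\<^sup>2 / 2) v"
    then show "boundary_condition bc a b u"
      by (rule boundary_condition_pullback[OF a ab radii _ \<tau>_scaleR, rotated -1]) (use u norm_\<tau> in auto)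
  qed
  ultimately show ?thesis unfolding solves_PA_def solves_PD_def by blast
qed

definition X where
  "X = {u \<in> extensional (closure A). C_holder 2 \<alpha> A u \<and> symA u}"

definition Y where
  "Y = {v \<in> extensional (closure D). C_holder 2 \<alpha> D v \<and> symD v}"

lemma pullback_\<sigma>_in_Y:
  assumes "u \<in> X"
  shows "restrict (\<lambda>z. u (\<sigma> z)) (closure D) \<in> Y"
proof -
  let ?v = "restrict (\<lambda>z. u (\<sigma> z)) (closure D)"
  have u: "full_hoelder 2 \<alpha> A u" "symA u" "continuous_on (closure A) u"
    using assms C_holder_imp_full_hoelder[OF a ab \<alpha>, of 2 u] C_holder_imp_continuous_on unfolding X_def by blast+
  have "full_hoelder 2 \<alpha> D ?v"
    using closure_subset by (intro full_hoelder_cong[OF open_annulus _ full_hoelder_pullback_\<sigma>[OF u(1,2)]]) auto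
  moreover have "continuous_on (closure D) (\<lambda>z. u (\<sigma> z))"
    using continuous_on_compose2[OF u(3) continuous_on_\<sigma>] \<sigma>_in(2) by blast
  then have "continuous_on (closure D) ?v" by (rule continuous_on_eq) simp
  ultimately have "C_holder 2 \<alpha> D ?v" using full_hoelder_imp_C_holder[OF open_annulus \<alpha>(1)] by blast
  moreover have "symD ?v" using symD_pullback_\<sigma>[OF u(2)] sym_restrict(2) by blast
  ultimately show ?thesis unfolding Y_def by blast
qed

lemma pullback_\<tau>_in_X:
  assumes "v \<in> Y"
  shows "restrict (\<lambda>x. v (\<tau> x)) (closure A) \<in> X"
proof -
  let ?u = "restrict (\<lambda>x. v (\<tau> x)) (closure A)"
  have v: "full_hoelder 2 \<alpha> D v" "symD v" "continuous_on (closure D) v"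
    using assms C_holder_imp_full_hoelder[OF radii \<alpha>, of 2 v] C_holder_imp_continuous_on unfolding Y_def by blast+
  have "full_hoelder 2 \<alpha> A ?u"
    using closure_subset by (intro full_hoelder_cong[OF open_annulus _ full_hoelder_pullback_\<tau>[OF v(1,2)]]) auto
  moreover have "continuous_on (closure A) (\<lambda>x. v (\<tau> x))"
    using continuous_on_compose2[OF v(3) continuous_on_\<tau>] \<tau>_in(2) by blast
  then have "continuous_on (closure A) ?u" by (rule continuous_on_eq) simp
  ultimately have "C_holder 2 \<alpha> A ?u" using full_hoelder_imp_C_holder[OF open_annulus \<alpha>(1)] by blast
  moreover have "symA ?u" using symA_pullback_\<tau>[OF v(2)] sym_restrict(1) by blast
  ultimately show ?thesis unfolding X_def by blast
qed

lemma pullback_inverses: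
  shows "u \<in> X \<Longrightarrow> restrict (\<lambda>x. restrict (\<lambda>z. u (\<sigma> z)) (closure D) (\<tau> x)) (closure A) = u"
    and "v \<in> Y \<Longrightarrow> restrict (\<lambda>z. restrict (\<lambda>x. v (\<tau> x)) (closure A) (\<sigma> z)) (closure D) = v"
proof -
  assume u: "u \<in> X"
  have "u (\<sigma> (\<tau> x)) = u x" if "x \<in> closure A" for x
    using u that \<sigma>_\<tau>[of x] \<sigma>_in(2) \<tau>_in(2) unfolding X_def symA_def by blast
  then show "restrict (\<lambda>x. restrict (\<lambda>z. u (\<sigma> z)) (closure D) (\<tau> x)) (closure A) = u"
    using u \<tau>_in(2) unfolding X_def by (intro extensionalityI[of _ "closure A"]) auto
next
  assume v: "v \<in> Y"
  have "v (\<tau> (\<sigma> z)) = v z" if "z \<in> closure D" for z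
    using v that \<tau>_\<sigma>[of z] \<sigma>_in(2) \<tau>_in(2) unfolding Y_def symD_def by blast
  then show "restrict (\<lambda>z. restrict (\<lambda>x. v (\<tau> x)) (closure A) (\<sigma> z)) (closure D) = v"
    using v \<sigma>_in(2) unfolding Y_def by (intro extensionalityI[of _ "closure D"]) auto
qed

lemma bij_betw_solutions:
  "bij_betw (\<lambda>u. restrict (\<lambda>z. u (\<sigma> z)) (closure D))
     {u \<in> X. solves_PA bc f a b u} {v \<in> Y. solves_PD bc f a b v}"
proof (rule bij_betw_byWitness[where f' = "\<lambda>v. restrict (\<lambda>x. v (\<tau> x)) (closure A)"])
  have iff: "solves_PA bc f a b u \<longleftrightarrow> solves_PD bc f a b v"
    if "v \<in> Y" "u = restrict (\<lambda>x. v (\<tau> x)) (closure A)" for u v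
    using that C_holder_imp_full_hoelder[OF radii \<alpha>, of 2 v] unfolding Y_def
    by (intro solves_PA_iff_solves_PD) auto
  show "(\<lambda>u. restrict (\<lambda>z. u (\<sigma> z)) (closure D)) ` {u \<in> X. solves_PA bc f a b u} \<subseteq> {v \<in> Y. solves_PD bc f a b v}"
  proof (rule image_subsetI)
    fix u assume "u \<in> {u \<in> X. solves_PA bc f a b u}"
    then have u: "u \<in> X" "solves_PA bc f a b u" by auto
    show "restrict (\<lambda>z. u (\<sigma> z)) (closure D) \<in> {v \<in> Y. solves_PD bc f a b v}"
      using pullback_\<sigma>_in_Y[OF u(1)] iff[OF pullback_\<sigma>_in_Y[OF u(1)] pullback_inverses(1)[OF u(1), symmetric]] u(2)
      by blast
  qed
  show "(\<lambda>v. restrict (\<lambda>x. v (\<tau> x)) (closure A)) ` {v \<in> Y. solves_PD bc f a b v} \<subseteq> {u \<in> X. solves_PA bc f a b u}"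
  proof (rule image_subsetI)
    fix v assume "v \<in> {v \<in> Y. solves_PD bc f a b v}"
    then have v: "v \<in> Y" "solves_PD bc f a b v" by auto
    show "restrict (\<lambda>x. v (\<tau> x)) (closure A) \<in> {u \<in> X. solves_PA bc f a b u}"
      using pullback_\<tau>_in_X[OF v(1)] iff[OF v(1) refl] v(2) by simp
  qed
qed (use pullback_inverses in auto)

end

theorem theorem1p1:
  fixes a b \<alpha> :: real
    and f :: "real \<Rightarrow> real"
    and bc :: boundary_type
    and p :: "real^'n"
  assumes "CARD('m::finite) \<ge> 2"
    and "CARD('n::finite) = CARD('m) + 1"
    and "0 < a" and "a < b"
    and "0 < \<alpha>" and "\<alpha> < 1"
    and "C1_holder_nonlinearity \<alpha> f"
    and "norm p = 1"
  shows "\<exists>T. bij_betw T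
           {u \<in> (space_X \<alpha> a b :: ((real^'m) \<times> (real^'m) \<Rightarrow> real) set). solves_PA bc f a b u}
           {v \<in> space_Y \<alpha> a b p. solves_PD bc f a b v}"
proof -
  have p: "p \<noteq> 0" "p \<bullet> p = 1" using assms(8) by (auto simp: dot_square_norm)
  (* the hyperplane orthogonal to p has the dimension of the factors of the other space *)
  have dim: "dim {z. p \<bullet> z = 0} = dim (UNIV :: (real^'m) set)"
    using dim_hyperplane[OF p(1)] assms(2) by (simp add: dim_UNIV)
  have "\<exists>(f' :: real^'n \<Rightarrow> real^'m) (g :: real^'m \<Rightarrow> real^'n). linear f' \<and> linear g \<and> range g = {z. p \<bullet> z = 0} \<and>
      (\<forall>z. p \<bullet> z = 0 \<longrightarrow> norm (f' z) = norm z) \<and> (\<forall>y. norm (g y) = norm y)"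
  proof (rule isometries_subspaces[OF subspace_hyperplane subspace_UNIV dim])
    fix f' :: "real^'n \<Rightarrow> real^'m" and g :: "real^'m \<Rightarrow> real^'n"
    assume "linear f'" "linear g" "g ` UNIV = {z. p \<bullet> z = 0}"
      "\<And>z. z \<in> {z. p \<bullet> z = 0} \<Longrightarrow> norm (f' z) = norm z" "\<And>y. y \<in> UNIV \<Longrightarrow> norm (g y) = norm y"
    then show ?thesis by (intro exI[of _ f'] exI[of _ g]) auto
  qed
  then obtain f' :: "real^'n \<Rightarrow> real^'m" and g :: "real^'m \<Rightarrow> real^'n" where fg: "linear f'" "linear g" "range g = {z. p \<bullet> z = 0}"
    "\<forall>z. p \<bullet> z = 0 \<longrightarrow> norm (f' z) = norm z" "\<forall>y. norm (g y) = norm y" by blast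
  obtain e :: "real^'m" where e: "norm e = 1" using vector_choose_size[of 1] by auto
  define K where "K = (\<lambda>z. f' (z - (z \<bullet> p) *\<^sub>R p))"
  have g0: "g y \<bullet> p = 0" for y
  proof -
    have "g y \<in> {z. p \<bullet> z = 0}" using fg(3) by blast
    then show ?thesis by (simp add: inner_commute)
  qed
  interpret annulus_correspondence a b \<alpha> p "g e" e g K
  proof (rule annulus_correspondence.intro)
    show "linear K" unfolding K_def
      by (rule linear_compose[OF _ fg(1), unfolded o_def])
        (rule linearI; simp add: scaleR_add_left inner_add_left scaleR_diff_right)
    show "(norm (K z))\<^sup>2 = (norm z)\<^sup>2 - (z \<bullet> p)\<^sup>2" for z
    proof -
      have "norm (K z) = norm (z - (z \<bullet> p) *\<^sub>R p)"
        unfolding K_def using p(2) by (intro fg(4)[rule_format]) (simp add: inner_diff_right inner_commute)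
      then have "(norm (K z))\<^sup>2 = (z - (z \<bullet> p) *\<^sub>R p) \<bullet> (z - (z \<bullet> p) *\<^sub>R p)"
        by (simp add: power2_norm_eq_inner)
      also have "\<dots> = z \<bullet> z - (z \<bullet> p)\<^sup>2"
        using p(2) by (simp add: inner_diff_left inner_diff_right inner_commute power2_eq_square)
      finally show ?thesis by (simp add: power2_norm_eq_inner)
    qed
  qed (use assms fg e g0 in auto)
  have "space_X \<alpha> a b = X"
    unfolding space_X_def X_def symA_def function_of_two_iff by blast
  moreover have "0 \<notin> closure D" using closure_annulus[OF radii, where 'a = "real^'n"] radii by auto
  then have "space_Y \<alpha> a b p = Y"
    unfolding space_Y_def Y_def symD_def using axially_symmetric_on_iff[OF assms(8)] by blast
  ultimately show ?thesis using bij_betw_solutions[of bc f] by auto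
qed

end
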